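(* Let $N\ge1$ be an integer and $a,b\in\mathbb{R}$ with $\frac{N-2}{2}<b\leq N-2$ and $N(b-a+3)=2(3b-a+3)$. There exists a universal constant $C(N,a,b)>0$ such that for all $u\in C_0^\infty(\mathbb{R}^N\setminus\{0\})$, $$\left(\int_{\mathbb{R}^N}\frac{|\nabla u|^2}{|x|^{2b}}dx\right)^{1/2}\left(\int_{\mathbb{R}^N}\frac{|u|^2}{|x|^{2a}}dx\right)^{1/2}-\frac{3b-a-N+3}{2}\int_{\mathbb{R}^N}\frac{|u|^2}{|x|^{a+b+1}}dx$$ $$\geq C(N,a,b)\inf_{c\in\mathbb{R},\,\lambda>0}\int_{\mathbb{R}^N}\frac{\left|u-c|x|^{2b+2-N}e^{-\frac{\lambda}{b+1-a}|x|^{b+1-a}}\right|^2}{|x|^{a+b+1}}dx.$$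
   Context: $C_0^\infty(\mathbb{R}^N\setminus\{0\})$ is the space of real-valued smooth functions with compact support in $\mathbb{R}^N\setminus\{0\}$. "Universal" means that the constant depends only on $N,a,b$ and not on $u$. *)

theory Defs
  imports "HOL-Analysis.Analysis"
begin

primrec C_k_on :: "nat \<Rightarrow> 'a::euclidean_space set \<Rightarrow> ('a \<Rightarrow> real) \<Rightarrow> bool" where
  "C_k_on 0 S f \<longleftrightarrow> continuous_on S f"
| "C_k_on (Suc k) S f \<longleftrightarrow>
     (\<forall>x\<in>S. f differentiable (at x)) \<and>
     (\<forall>i\<in>Basis. C_k_on k S (\<lambda>x. frechet_derivative f (at x) i))"

text \<open>Derivatives are taken at \<open>x\<close>, not within \<open>S\<close>, so this is meant for open \<open>S\<close>.\<close>

definition smooth_on :: "'a::euclidean_space set \<Rightarrow> ('a \<Rightarrow> real) \<Rightarrow> bool" where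
  "smooth_on S f \<longleftrightarrow> (\<forall>k. C_k_on k S f)"

text \<open>The space of smooth functions with compact support in the open set \<open>S\<close>. An element is a
  function on the whole space, and the condition on the support makes it vanish outside \<open>S\<close>.\<close>

definition test_functions :: "'a::euclidean_space set \<Rightarrow> ('a \<Rightarrow> real) set" where
  "test_functions S =
     {u. smooth_on S u \<and> compact (closure {x. u x \<noteq> 0}) \<and> closure {x. u x \<noteq> 0} \<subseteq> S}"

definition gradient :: "('a::euclidean_space \<Rightarrow> real) \<Rightarrow> 'a \<Rightarrow> 'a" where
  "gradient u x = (THE D. GDERIV u x :> D)"

end

theory Submission
  imports Defs "HOL-Probability.Distributions"
begin

text \<open>
  The weighted inequality is reduced to the Poincare inequality for a Gaussian weight. Let
  \<open>s = 2 * b + 2 - N\<close> and \<open>\<beta> = b + 1 - a\<close>, and let \<open>\<psi>\<close> be the extremal function with parameter \<open>l > 0\<close> and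
  \<open>c = 1\<close>. Put \<open>u = f \<psi>\<close>. Write \<open>A\<close> for the weighted energy of \<open>u\<close>, \<open>B\<close> and \<open>D\<close> for the integrals of
  \<open>u\<^sup>2\<close> against the powers \<open>- 2 * a\<close> and \<open>- (a + b + 1)\<close> of the norm, and \<open>k\<close> for the coefficient
  \<open>(3 * b - a - N + 3) / 2\<close> of \<open>D\<close>. Completing the square (\<open>complete_square\<close>) yields
  \<open>A + l\<^sup>2 B - 2 l k D = \<integral> (norm (\<nabla>f))\<^sup>2 \<psi>\<^sup>2 / norm x powr (2 * b)\<close>.
  On the other side, the squared distance from \<open>u\<close> to \<open>c \<psi>\<close> is
  \<open>\<integral> (f - c)\<^sup>2 \<psi>\<^sup>2 / norm x powr (a + b + 1)\<close>. So what is needed is a Poincare inequality relating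
  these two weights, with a constant proportional to \<open>1 / l\<close>.

  The hypotheses are made for this. The relation between \<open>a\<close>, \<open>b\<close> and \<open>N\<close> says that \<open>\<beta> = 2 * \<kappa>\<close> with
  \<open>\<kappa> = s / (N - 2)\<close>, and the bounds on \<open>b\<close> say that \<open>0 < \<kappa> \<le> 1\<close>. The radial map that replaces
  \<open>norm x\<close> by \<open>norm x powr \<kappa>\<close> then carries the measure of the second integral to a multiple of a
  Gaussian measure in the same dimension (\<open>nn_integral_radial_power_map\<close>). Since \<open>\<kappa> \<le> 1\<close>, it compresses
  the radial direction at least as much as the tangential ones, so the Gaussian energy of the
  transported function is at most \<open>1 / \<kappa>\<close> times the first integral. This gives
  \<open>radial_power_weight_poincare\<close>.

  Any constant suffices in the Gaussian inequality \<open>gaussian_poincare\<close>, which is proved by joining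
  two independent points by a quarter of an ellipse and using the rotation invariance of the product
  of two Gaussian weights. As the resulting estimate
  \<open>A + l\<^sup>2 B - 2 l k D \<ge> 2 l C inf\<close> holds for all \<open>l > 0\<close> with the same infimum, minimising over \<open>l\<close>
  (\<open>geometric_mean_ge\<close>) turns \<open>A + l\<^sup>2 B\<close> into twice \<open>l\<close> times the product of the square roots.
\<close>

section \<open>Radial power changes of variables\<close>

lemma nn_integral_lborel_affine:
  fixes h :: "'a::euclidean_space \<Rightarrow> ennreal"
  assumes [measurable]: "h \<in> borel_measurable borel" and c: "c \<noteq> 0"
  shows "(\<integral>\<^sup>+x. h x \<partial>lborel) = ennreal (\<bar>c\<bar> ^ DIM('a)) * (\<integral>\<^sup>+x. h (t + c *\<^sub>R x) \<partial>lborel)"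
proof -
  have "(\<integral>\<^sup>+x. h x \<partial>lborel) =
      (\<integral>\<^sup>+x. h x \<partial>density (distr lborel borel (\<lambda>x. t + c *\<^sub>R x)) (\<lambda>_. \<bar>c\<bar> ^ DIM('a)))"
    by (subst lborel_affine[OF c]) simp
  also have "\<dots> = ennreal (\<bar>c\<bar> ^ DIM('a)) * (\<integral>\<^sup>+x. h (t + c *\<^sub>R x) \<partial>lborel)"
    by (simp add: nn_integral_density nn_integral_distr nn_integral_cmult)
  finally show ?thesis .
qed

text \<open>
  A substitute for polar coordinates that needs nothing but Tonelli and scaling. Every ray through
  a point \<open>y \<noteq> 0\<close> is traversed by the dilations \<open>exp t\<close>, and the parameters \<open>t\<close> for which
  \<open>z = exp (- t) *\<^sub>R y\<close> lies in the shell \<open>1 \<le> norm z < exp 1\<close> form an interval of length 1. Inserting this length under the integral,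
  exchanging the integrals and substituting \<open>y = exp t *\<^sub>R z\<close> moves the integration to the shell.
\<close>

lemma nn_integral_shell_rays:
  fixes h :: "'a::euclidean_space \<Rightarrow> ennreal"
  assumes [measurable]: "h \<in> borel_measurable borel"
  shows "(\<integral>\<^sup>+y. h y \<partial>lborel) =
    (\<integral>\<^sup>+z. indicator {1..<exp 1} (norm z) *
       (\<integral>\<^sup>+t. h (exp t *\<^sub>R z) * ennreal (exp (DIM('a) * t)) \<partial>lborel) \<partial>lborel)"
proof -
  let ?I = "indicator {1..<exp 1} :: real \<Rightarrow> ennreal"
  have unit: "(\<integral>\<^sup>+t. ?I (norm (exp (-t) *\<^sub>R y)) \<partial>lborel) = 1" if "y \<noteq> 0" for y :: 'a
  proof -
    have "?I (norm (exp (-t) *\<^sub>R y)) = indicator {ln (norm y) - 1<..ln (norm y)} t" for t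
    proof -
      have "norm (exp (-t) *\<^sub>R y) = exp (ln (norm y) - t)"
        using that by (simp add: exp_diff exp_minus field_simps)
      then show ?thesis
        by (simp split: split_indicator)
    qed
    then show ?thesis by simp
  qed
  have "AE y in lborel. y \<noteq> (0::'a)"
    by (rule AE_lborel_singleton)
  then have "(\<integral>\<^sup>+y. h y \<partial>lborel) = (\<integral>\<^sup>+y. (\<integral>\<^sup>+t. h y * ?I (norm (exp (-t) *\<^sub>R y)) \<partial>lborel) \<partial>lborel)"
    by (intro nn_integral_cong_AE) (auto simp: nn_integral_cmult unit simp del: norm_scaleR)
  also have "\<dots> = (\<integral>\<^sup>+t. (\<integral>\<^sup>+y. h y * ?I (norm (exp (-t) *\<^sub>R y)) \<partial>lborel) \<partial>lborel)"
    by (rule lborel_pair.Fubini') measurable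
  also have "\<dots> = (\<integral>\<^sup>+t. (\<integral>\<^sup>+z. ?I (norm z) * (h (exp t *\<^sub>R z) * ennreal (exp (DIM('a) * t))) \<partial>lborel) \<partial>lborel)"
  proof (rule nn_integral_cong)
    fix t :: real
    have "(\<integral>\<^sup>+y. h y * ?I (norm (exp (-t) *\<^sub>R y)) \<partial>lborel)
        = ennreal (\<bar>exp t\<bar> ^ DIM('a)) * (\<integral>\<^sup>+z. h (exp t *\<^sub>R z) * ?I (norm z) \<partial>lborel)"
      by (subst nn_integral_lborel_affine[where c="exp t" and t=0])
        (simp_all add: exp_minus)
    also have "\<dots> = (\<integral>\<^sup>+z. ?I (norm z) * (h (exp t *\<^sub>R z) * ennreal (exp (DIM('a) * t))) \<partial>lborel)"
      by (subst nn_integral_cmult[symmetric]) (simp_all add: exp_of_nat_mult exp_of_nat2_mult ac_simps)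
    finally show "(\<integral>\<^sup>+y. h y * ?I (norm (exp (-t) *\<^sub>R y)) \<partial>lborel) = \<dots>" .
  qed
  also have "\<dots> = (\<integral>\<^sup>+z. (\<integral>\<^sup>+t. ?I (norm z) * (h (exp t *\<^sub>R z) * ennreal (exp (DIM('a) * t))) \<partial>lborel) \<partial>lborel)"
    by (rule lborel_pair.Fubini') measurable
  also have "\<dots> = (\<integral>\<^sup>+z. ?I (norm z) * (\<integral>\<^sup>+t. h (exp t *\<^sub>R z) * ennreal (exp (DIM('a) * t)) \<partial>lborel) \<partial>lborel)"
    by (intro nn_integral_cong nn_integral_cmult) measurable
  finally show ?thesis .
qed

text \<open>
  The map \<open>x \<mapsto> norm x powr (k - 1) *\<^sub>R x\<close> preserves every ray, and acts on its logarithmic parameter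
  by \<open>t \<mapsto> k * t + const\<close>. After integrating along rays, the change of variables is therefore an affine
  substitution on the real line; the factor \<open>k * norm x powr (DIM('a) * (k - 1))\<close> is the Jacobian.
\<close>

lemma nn_integral_radial_power_map:
  fixes h :: "'a::euclidean_space \<Rightarrow> ennreal" and k :: real
  assumes [measurable]: "h \<in> borel_measurable borel" and k: "k > 0"
  shows "(\<integral>\<^sup>+x. h (norm x powr (k - 1) *\<^sub>R x) * ennreal (k * norm x powr (DIM('a) * (k - 1))) \<partial>lborel) =
    (\<integral>\<^sup>+y. h y \<partial>lborel)"
proof -
  let ?I = "indicator {1..<exp 1} :: real \<Rightarrow> ennreal"
  let ?N = "real DIM('a)"
  have "(\<integral>\<^sup>+x. h (norm x powr (k - 1) *\<^sub>R x) * ennreal (k * norm x powr (?N * (k - 1))) \<partial>lborel) =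
    (\<integral>\<^sup>+z. ?I (norm z) *
       (\<integral>\<^sup>+t. h (norm (exp t *\<^sub>R z) powr (k - 1) *\<^sub>R (exp t *\<^sub>R z)) *
          ennreal (k * norm (exp t *\<^sub>R z) powr (?N * (k - 1))) * ennreal (exp (?N * t)) \<partial>lborel) \<partial>lborel)"
    by (subst nn_integral_shell_rays) simp_all
  also have "\<dots> = (\<integral>\<^sup>+z. ?I (norm z) * (\<integral>\<^sup>+t. h (exp t *\<^sub>R z) * ennreal (exp (?N * t)) \<partial>lborel) \<partial>lborel)"
  proof (rule nn_integral_cong, goal_cases)
    case (1 z)
    show ?case
    proof (cases "z = 0")
      case False
      define L where "L = ln (norm z)"
      have nz: "norm z = exp L" using False by (simp add: L_def)
      have "(\<integral>\<^sup>+t. h (exp t *\<^sub>R z) * ennreal (exp (?N * t)) \<partial>lborel) =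
        ennreal k * (\<integral>\<^sup>+t. h (exp ((k - 1) * L + k * t) *\<^sub>R z) * ennreal (exp (?N * ((k - 1) * L + k * t))) \<partial>lborel)"
        using k by (subst nn_integral_lborel_affine[where c=k and t="(k - 1) * L"]) simp_all
      also have "\<dots> = (\<integral>\<^sup>+t. ennreal k * (h (exp ((k - 1) * L + k * t) *\<^sub>R z) * ennreal (exp (?N * ((k - 1) * L + k * t)))) \<partial>lborel)"
        by (subst nn_integral_cmult) simp_all
      also have "\<dots> = (\<integral>\<^sup>+t. h (norm (exp t *\<^sub>R z) powr (k - 1) *\<^sub>R (exp t *\<^sub>R z)) *
          ennreal (k * norm (exp t *\<^sub>R z) powr (?N * (k - 1))) * ennreal (exp (?N * t)) \<partial>lborel)"
      proof (rule nn_integral_cong, goal_cases)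
        case (1 t)
        have n: "norm (exp t *\<^sub>R z) = exp (t + L)" by (simp add: nz exp_add)
        have e1: "norm (exp t *\<^sub>R z) powr (k - 1) *\<^sub>R (exp t *\<^sub>R z) = exp ((k - 1) * L + k * t) *\<^sub>R z"
          unfolding n by (simp add: powr_def flip: exp_add) (simp add: algebra_simps)
        have e2: "k * norm (exp t *\<^sub>R z) powr (?N * (k - 1)) * exp (?N * t) = k * exp (?N * ((k - 1) * L + k * t))"
          unfolding n by (simp add: powr_def mult.assoc flip: exp_add) (simp add: algebra_simps)
        show ?case unfolding e1 mult.assoc using k
          by (subst ennreal_mult[symmetric], simp, simp, subst e2) (simp add: ennreal_mult ac_simps)
      qed
      finally show ?thesis by simp
    qed simp
  qed
  also have "\<dots> = (\<integral>\<^sup>+y. h y \<partial>lborel)"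
    by (rule nn_integral_shell_rays[symmetric]) simp
  finally show ?thesis .
qed

section \<open>The Poincare inequality for Gaussian weights\<close>

lemma square_increment_le_energy:
  fixes f f' :: "real \<Rightarrow> real"
  assumes L: "L > 0"
    and f: "\<And>t. t \<in> {0..L} \<Longrightarrow> (f has_real_derivative f' t) (at t)"
    and f': "continuous_on {0..L} f'"
  shows "ennreal ((f L - f 0)\<^sup>2) \<le> ennreal L * (\<integral>\<^sup>+t. indicator {0..L} t * ennreal ((f' t)\<^sup>2) \<partial>lborel)"
proof -
  define m where "m = (f L - f 0) / L"
  let ?I = "indicator {0..L} :: real \<Rightarrow> real"
  have int: "integrable lborel (\<lambda>t. ?I t * h t)" if "continuous_on {0..L} h" for h :: "real \<Rightarrow> real"
    using borel_integrable_compact[OF compact_Icc that] by simp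
  have FTC: "(\<integral>t. ?I t * f' t \<partial>lborel) = f L - f 0"
    using integral_FTC_atLeastAtMost[of 0 L f f'] L f f'
    by (auto simp: has_real_derivative_iff_has_vector_derivative intro: has_vector_derivative_at_within)
  have sq: "integrable lborel (\<lambda>t. ?I t * (f' t)\<^sup>2)"
    by (intro int continuous_intros f')
  \<comment> \<open>\<open>m\<close> is the mean slope; the variance of the slope is nonnegative.\<close>
  have "0 \<le> (\<integral>t. ?I t * (f' t - m)\<^sup>2 \<partial>lborel)"
    by (intro integral_nonneg_AE) auto
  also have "\<dots> = (\<integral>t. ?I t * (f' t)\<^sup>2 - 2 * m * (?I t * f' t) + m\<^sup>2 * (?I t * 1) \<partial>lborel)"
    by (intro Bochner_Integration.integral_cong) (auto simp: power2_eq_square algebra_simps)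
  also have "\<dots> = (\<integral>t. ?I t * (f' t)\<^sup>2 \<partial>lborel) - 2 * m * (f L - f 0) + m\<^sup>2 * L"
    using sq int[OF f'] int[of "\<lambda>_. 1"] L by (simp add: FTC)
  also have "\<dots> = (\<integral>t. ?I t * (f' t)\<^sup>2 \<partial>lborel) - (f L - f 0)\<^sup>2 / L"
    using L by (simp add: m_def power2_eq_square field_simps)
  finally have "(f L - f 0)\<^sup>2 \<le> L * (\<integral>t. ?I t * (f' t)\<^sup>2 \<partial>lborel)"
    using L by (simp add: field_simps)
  then have "ennreal ((f L - f 0)\<^sup>2) \<le> ennreal L * ennreal (\<integral>t. ?I t * (f' t)\<^sup>2 \<partial>lborel)"
    using L by (simp add: ennreal_mult'[symmetric] ennreal_leI)
  also have "ennreal (\<integral>t. ?I t * (f' t)\<^sup>2 \<partial>lborel) = (\<integral>\<^sup>+t. ennreal (?I t * (f' t)\<^sup>2) \<partial>lborel)"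
    by (rule nn_integral_eq_integral[OF sq, symmetric]) simp
  also have "\<dots> = (\<integral>\<^sup>+t. indicator {0..L} t * ennreal ((f' t)\<^sup>2) \<partial>lborel)"
    by (intro nn_integral_cong) (auto split: split_indicator)
  finally show ?thesis .
qed

text \<open>
  Lebesgue measure on pairs is invariant under the rotation that mixes the two components. Each of
  the two substitutions, first in \<open>y\<close> for fixed \<open>x\<close> and then in \<open>x\<close> for fixed image \<open>z\<close>, is affine,
  with Jacobians \<open>s\<close> to the powers \<open>- DIM('a)\<close> and \<open>DIM('a)\<close>, which cancel.
\<close>

lemma nn_integral_rotate:
  fixes F :: "'a::euclidean_space \<Rightarrow> 'a \<Rightarrow> ennreal"
  assumes [measurable]: "(\<lambda>(x, y). F x y) \<in> borel_measurable (borel \<Otimes>\<^sub>M borel)"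
    and cs: "c\<^sup>2 + s\<^sup>2 = 1" and s: "s > 0"
  shows "(\<integral>\<^sup>+x. \<integral>\<^sup>+y. F (c *\<^sub>R x + s *\<^sub>R y) (c *\<^sub>R y - s *\<^sub>R x) \<partial>lborel \<partial>lborel) =
    (\<integral>\<^sup>+x. \<integral>\<^sup>+y. F x y \<partial>lborel \<partial>lborel)"
proof -
  have "(\<integral>\<^sup>+x. \<integral>\<^sup>+y. F (c *\<^sub>R x + s *\<^sub>R y) (c *\<^sub>R y - s *\<^sub>R x) \<partial>lborel \<partial>lborel) =
    (\<integral>\<^sup>+x. \<integral>\<^sup>+z. ennreal ((1 / s) ^ DIM('a)) * F z ((1 / s) *\<^sub>R (c *\<^sub>R z - x)) \<partial>lborel \<partial>lborel)"
  proof (rule nn_integral_cong, goal_cases)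
    case (1 x)
    have e: "c *\<^sub>R (- (c / s) *\<^sub>R x + (1 / s) *\<^sub>R z) - s *\<^sub>R x = (1 / s) *\<^sub>R (c *\<^sub>R z - x)" for z
    proof -
      have "c *\<^sub>R (- (c / s) *\<^sub>R x + (1 / s) *\<^sub>R z) - s *\<^sub>R x = (c / s) *\<^sub>R z - ((c\<^sup>2 + s\<^sup>2) / s) *\<^sub>R x"
        using s by (simp add: algebra_simps power2_eq_square add_divide_distrib)
      then show ?thesis by (simp add: cs algebra_simps)
    qed
    have "(\<integral>\<^sup>+y. F (c *\<^sub>R x + s *\<^sub>R y) (c *\<^sub>R y - s *\<^sub>R x) \<partial>lborel) =
      ennreal (\<bar>1 / s\<bar> ^ DIM('a)) *
        (\<integral>\<^sup>+z. F (c *\<^sub>R x + s *\<^sub>R (- (c / s) *\<^sub>R x + (1 / s) *\<^sub>R z))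
           (c *\<^sub>R (- (c / s) *\<^sub>R x + (1 / s) *\<^sub>R z) - s *\<^sub>R x) \<partial>lborel)"
      using s by (intro nn_integral_lborel_affine) auto
    also have "\<dots> = (\<integral>\<^sup>+z. ennreal ((1 / s) ^ DIM('a)) * F z ((1 / s) *\<^sub>R (c *\<^sub>R z - x)) \<partial>lborel)"
      unfolding e using s by (subst nn_integral_cmult[symmetric]) (simp_all add: algebra_simps)
    finally show ?case .
  qed
  also have "\<dots> = (\<integral>\<^sup>+z. \<integral>\<^sup>+x. ennreal ((1 / s) ^ DIM('a)) * F z ((1 / s) *\<^sub>R (c *\<^sub>R z - x)) \<partial>lborel \<partial>lborel)"
    by (rule lborel_pair.Fubini') measurable
  also have "\<dots> = (\<integral>\<^sup>+x. \<integral>\<^sup>+y. F x y \<partial>lborel \<partial>lborel)"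
  proof (rule nn_integral_cong, goal_cases)
    case (1 z)
    have "(\<integral>\<^sup>+x. ennreal ((1 / s) ^ DIM('a)) * F z ((1 / s) *\<^sub>R (c *\<^sub>R z - x)) \<partial>lborel) =
      ennreal (\<bar>- s\<bar> ^ DIM('a)) * (\<integral>\<^sup>+y. ennreal ((1 / s) ^ DIM('a)) *
         F z ((1 / s) *\<^sub>R (c *\<^sub>R z - (c *\<^sub>R z + (- s) *\<^sub>R y))) \<partial>lborel)"
      using s by (intro nn_integral_lborel_affine) auto
    also have "\<dots> = (\<integral>\<^sup>+y. ennreal (s ^ DIM('a) * (1 / s) ^ DIM('a)) * F z y \<partial>lborel)"
      using s by (subst nn_integral_cmult[symmetric]) (simp_all add: ennreal_mult mult.assoc)
    also have "s ^ DIM('a) * (1 / s) ^ DIM('a) = 1"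
      using s by (simp flip: power_mult_distrib)
    finally show ?case by simp
  qed
  finally show ?thesis .
qed

lemma nn_integral_gaussian_finite:
  "(\<integral>\<^sup>+(x::'a::euclidean_space). ennreal (exp (- (norm x)\<^sup>2 / 2)) \<partial>lborel) < \<infinity>"
proof -
  have 1: "(\<integral>\<^sup>+x. ennreal (exp (- x\<^sup>2 / 2)) \<partial>lborel) < \<infinity>"
  proof -
    have "integrable lborel (\<lambda>x. sqrt (2 * pi) * std_normal_density x)"
      by simp
    then have "integrable lborel (\<lambda>x::real. exp (- x\<^sup>2 / 2))"
      by (simp add: std_normal_density_def)
    then show ?thesis
      by (subst nn_integral_eq_integral) auto
  qed
  have "exp (- (norm x)\<^sup>2 / 2) = (\<Prod>b\<in>Basis. exp (- (x \<bullet> b)\<^sup>2 / 2))" for x :: 'a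
  proof -
    have "(norm x)\<^sup>2 = (\<Sum>b\<in>Basis. (x \<bullet> b)\<^sup>2)"
      unfolding power2_norm_eq_inner by (subst euclidean_inner) (simp add: power2_eq_square)
    then have "- (norm x)\<^sup>2 / 2 = (\<Sum>b\<in>Basis. - (x \<bullet> b)\<^sup>2 / 2)"
      by (simp add: sum_negf sum_divide_distrib)
    then show ?thesis by (simp add: exp_sum)
  qed
  then have "(\<integral>\<^sup>+(x::'a). ennreal (exp (- (norm x)\<^sup>2 / 2)) \<partial>lborel) =
     (\<integral>\<^sup>+(x::'a). (\<Prod>b\<in>Basis. ennreal (exp (- (x \<bullet> b)\<^sup>2 / 2))) \<partial>lborel)"
    by (simp add: prod_ennreal)
  also have "\<dots> = (\<Prod>b\<in>(Basis::'a set). \<integral>\<^sup>+x. ennreal (exp (- x\<^sup>2 / 2)) \<partial>lborel)"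
    by (rule nn_integral_lborel_prod) simp_all
  also have "\<dots> < \<infinity>"
    using 1 by (auto simp: power_less_top_ennreal)
  finally show ?thesis .
qed

definition gauss_weight :: "real \<Rightarrow> 'a::euclidean_space \<Rightarrow> real" where
  "gauss_weight \<alpha> x = exp (- \<alpha> * (norm x)\<^sup>2)"

lemma gauss_weight_measurable [measurable]: "gauss_weight \<alpha> \<in> borel_measurable borel"
  unfolding gauss_weight_def by measurable

lemma gauss_weight_pos: "gauss_weight \<alpha> x > 0"
  by (simp add: gauss_weight_def)

definition gauss_mass :: "'a::euclidean_space itself \<Rightarrow> real \<Rightarrow> ennreal" where
  "gauss_mass _ \<alpha> = (\<integral>\<^sup>+(x::'a). ennreal (gauss_weight \<alpha> x) \<partial>lborel)"

definition gauss_second_moment :: "'a::euclidean_space itself \<Rightarrow> real \<Rightarrow> ennreal" where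
  "gauss_second_moment _ \<alpha> = (\<integral>\<^sup>+(x::'a). ennreal ((norm x)\<^sup>2 * gauss_weight \<alpha> x) \<partial>lborel)"

text \<open>
  Scaling shows how the mass and the second moment depend on \<open>\<alpha>\<close>: their ratio is proportional to
  \<open>1 / \<alpha>\<close>, with a constant depending on the dimension only. This makes the constant of the
  Poincare inequality uniform in \<open>\<alpha>\<close>.
\<close>

lemma gauss_mass_scale:
  assumes "\<alpha> > 0"
  shows "gauss_mass TYPE('a::euclidean_space) \<alpha> =
    ennreal ((1 / sqrt \<alpha>) ^ DIM('a)) * gauss_mass TYPE('a) 1"
  unfolding gauss_mass_def using assms
  by (subst nn_integral_lborel_affine[where c="1 / sqrt \<alpha>" and t=0])
    (simp_all add: gauss_weight_def power_mult_distrib power_divide)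

lemma gauss_second_moment_scale:
  assumes "\<alpha> > 0"
  shows "ennreal \<alpha> * gauss_second_moment TYPE('a::euclidean_space) \<alpha> =
    ennreal ((1 / sqrt \<alpha>) ^ DIM('a)) * gauss_second_moment TYPE('a) 1"
proof -
  have "ennreal \<alpha> * gauss_second_moment TYPE('a) \<alpha> =
      (\<integral>\<^sup>+(x::'a). ennreal (\<alpha> * (norm x)\<^sup>2 * gauss_weight \<alpha> x) \<partial>lborel)"
    unfolding gauss_second_moment_def using assms
    by (subst nn_integral_cmult[symmetric]) (simp_all add: ennreal_mult mult.assoc gauss_weight_def)
  also have "\<dots> = ennreal ((1 / sqrt \<alpha>) ^ DIM('a)) * gauss_second_moment TYPE('a) 1"
    unfolding gauss_second_moment_def using assms
    by (subst nn_integral_lborel_affine[where c="1 / sqrt \<alpha>" and t=0])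
      (simp_all add: gauss_weight_def power_mult_distrib power_divide)
  finally show ?thesis .
qed

lemma gauss_second_moment_finite: "gauss_second_moment TYPE('a::euclidean_space) 1 < \<infinity>"
proof -
  have "(norm x)\<^sup>2 * gauss_weight 1 x \<le> 2 * exp (- (norm x)\<^sup>2 / 2)" for x :: 'a
  proof -
    define t where "t = (norm x)\<^sup>2"
    have "t / 2 \<le> exp (t / 2)" using exp_ge_add_one_self[of "t / 2"] by linarith
    then have "t * exp (- t) \<le> 2 * exp (t / 2) * exp (- t)"
      by (intro mult_right_mono) auto
    also have "\<dots> = 2 * exp (- t / 2)"
      by (simp flip: exp_add)
    finally show ?thesis by (simp add: gauss_weight_def t_def)
  qed
  then have "ennreal ((norm x)\<^sup>2 * gauss_weight 1 x) \<le> ennreal 2 * ennreal (exp (- (norm x)\<^sup>2 / 2))" for x :: 'a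
    by (subst ennreal_mult[symmetric]) (auto intro: ennreal_leI)
  then have "gauss_second_moment TYPE('a) 1 \<le> (\<integral>\<^sup>+(x::'a). ennreal 2 * ennreal (exp (- (norm x)\<^sup>2 / 2)) \<partial>lborel)"
    unfolding gauss_second_moment_def by (intro nn_integral_mono)
  also have "\<dots> = ennreal 2 * (\<integral>\<^sup>+(x::'a). ennreal (exp (- (norm x)\<^sup>2 / 2)) \<partial>lborel)"
    by (rule nn_integral_cmult) measurable
  also have "\<dots> < \<infinity>"
    using nn_integral_gaussian_finite[where 'a='a] by (simp add: ennreal_mult_less_top)
  finally show ?thesis .
qed

lemma gauss_mass_finite: "gauss_mass TYPE('a::euclidean_space) 1 < \<infinity>"
proof -
  have "gauss_mass TYPE('a) 1 \<le> (\<integral>\<^sup>+(x::'a). ennreal (exp (- (norm x)\<^sup>2 / 2)) \<partial>lborel)"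
    unfolding gauss_mass_def by (intro nn_integral_mono) (simp add: gauss_weight_def)
  also have "\<dots> < \<infinity>" by (rule nn_integral_gaussian_finite)
  finally show ?thesis .
qed

lemma gauss_mass_pos: "gauss_mass TYPE('a::euclidean_space) 1 > 0"
proof -
  have "gauss_mass TYPE('a) 1 \<noteq> 0"
  proof
    assume "gauss_mass TYPE('a) 1 = 0"
    then have "AE x::'a in lborel. False"
      unfolding gauss_mass_def by (subst (asm) nn_integral_0_iff_AE) (auto simp: gauss_weight_def)
    then show False
      using emeasure_lborel_UNIV[where 'a='a] by (simp add: eventually_False trivial_limit_def[symmetric] ae_filter_eq_bot_iff)
  qed
  then show ?thesis by (simp add: zero_less_iff_neq_zero)
qed

lemma GDERIV_imp_continuous_on:
  assumes "\<And>x. GDERIV u x :> g x"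
  shows "continuous_on UNIV u"
  using assms unfolding gderiv_def
  by (intro has_derivative_continuous_on) auto

lemma gauss_weight_rotate:
  assumes "c\<^sup>2 + s\<^sup>2 = 1"
  shows "gauss_weight \<alpha> (c *\<^sub>R x + s *\<^sub>R y) * gauss_weight \<alpha> (c *\<^sub>R y - s *\<^sub>R x) =
    gauss_weight \<alpha> x * gauss_weight \<alpha> y"
proof -
  have "(norm (c *\<^sub>R x + s *\<^sub>R y))\<^sup>2 + (norm (c *\<^sub>R y - s *\<^sub>R x))\<^sup>2
    = (c\<^sup>2 + s\<^sup>2) * ((norm x)\<^sup>2 + (norm y)\<^sup>2)"
    unfolding power2_norm_eq_inner by (simp add: algebra_simps inner_commute power2_eq_square)
  then have e: "(norm (c *\<^sub>R x + s *\<^sub>R y))\<^sup>2 + (norm (c *\<^sub>R y - s *\<^sub>R x))\<^sup>2 = (norm x)\<^sup>2 + (norm y)\<^sup>2"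
    by (simp add: assms)
  have "exp (- \<alpha> * P) * exp (- \<alpha> * Q) = exp (- \<alpha> * (P + Q))" for P Q :: real
    by (simp add: algebra_simps flip: exp_add)
  then show ?thesis unfolding gauss_weight_def by (simp only: e)
qed

text \<open>
  Two points \<open>x\<close> and \<open>y\<close> are joined by the arc \<open>cos t *\<^sub>R x + sin t *\<^sub>R y\<close>, \<open>0 \<le> t \<le> pi / 2\<close>, rather
  than by a segment: the position on the arc and its velocity form the rotated pair, so for the
  product of two equal Gaussian weights they are distributed as \<open>(x, y)\<close> itself, for every \<open>t\<close>.
  Hence the energy along the arc, averaged over all pairs, does not depend on \<open>t\<close>. The constant
  is not optimal.
\<close>

lemma pair_difference_energy:
  fixes W :: "'a::euclidean_space \<Rightarrow> real"
  assumes g: "\<And>x. GDERIV W x :> g x" and cont: "continuous_on UNIV g"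
  shows "(\<integral>\<^sup>+x. \<integral>\<^sup>+y. ennreal ((W y - W x)\<^sup>2 * (gauss_weight \<alpha> x * gauss_weight \<alpha> y)) \<partial>lborel \<partial>lborel) \<le>
    ennreal (pi\<^sup>2 / 4) * ((\<integral>\<^sup>+x. ennreal ((norm (g x))\<^sup>2 * gauss_weight \<alpha> x) \<partial>lborel) * gauss_second_moment TYPE('a) \<alpha>)"
    (is "?lhs \<le> _ * (?G * _)")
proof -
  let ?w = "gauss_weight \<alpha> :: 'a \<Rightarrow> real"
  have [measurable]: "g \<in> borel_measurable borel"
    using cont by (rule borel_measurable_continuous_onI)
  have [measurable]: "W \<in> borel_measurable borel"
    using GDERIV_imp_continuous_on[OF g] by (rule borel_measurable_continuous_onI)
  define L :: real where "L = pi / 2"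
  have L: "L > 0" by (simp add: L_def)
  define F where "F x y = ennreal ((g x \<bullet> y)\<^sup>2 * (?w x * ?w y))" for x y
  have [measurable]: "(\<lambda>(x, y). F x y) \<in> borel_measurable (borel \<Otimes>\<^sub>M borel)"
    unfolding F_def by measurable
  have path: "ennreal ((W y - W x)\<^sup>2 * (?w x * ?w y)) \<le> ennreal L * (\<integral>\<^sup>+t. indicator {0..L} t *
      F (cos t *\<^sub>R x + sin t *\<^sub>R y) (cos t *\<^sub>R y - sin t *\<^sub>R x) \<partial>lborel)" for x y
  proof -
    let ?z = "\<lambda>t. cos t *\<^sub>R x + sin t *\<^sub>R y"
    let ?z' = "\<lambda>t. cos t *\<^sub>R y - sin t *\<^sub>R x"
    have der: "((\<lambda>t. W (?z t)) has_real_derivative g (?z t) \<bullet> ?z' t) (at t)" for t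
    proof -
      have "(?z has_vector_derivative ?z' t) (at t)"
        by (auto intro!: derivative_eq_intros)
      then have "((\<lambda>t. W (?z t)) has_derivative (\<lambda>h. (h *\<^sub>R ?z' t) \<bullet> g (?z t))) (at t)"
        unfolding has_vector_derivative_def
        by (rule has_derivative_compose) (use g[of "?z t"] in \<open>simp add: gderiv_def\<close>)
      then show ?thesis
        unfolding has_field_derivative_def
        by (rule has_derivative_eq_rhs) (simp add: fun_eq_iff inner_commute)
    qed
    have z: "continuous_on S (\<lambda>t. g (?z t))" for S
      by (intro continuous_on_compose2[OF cont] continuous_intros) auto
    have "ennreal ((W (?z L) - W (?z 0))\<^sup>2) \<le> ennreal L * (\<integral>\<^sup>+t. indicator {0..L} t * ennreal ((g (?z t) \<bullet> ?z' t)\<^sup>2) \<partial>lborel)"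
      by (intro square_increment_le_energy L der continuous_intros z)
    then have "ennreal (?w x * ?w y) * ennreal ((W y - W x)\<^sup>2) \<le>
      ennreal (?w x * ?w y) * (ennreal L * (\<integral>\<^sup>+t. indicator {0..L} t * ennreal ((g (?z t) \<bullet> ?z' t)\<^sup>2) \<partial>lborel))"
      by (intro mult_left_mono) (simp_all add: L_def)
    also have "\<dots> = ennreal L * (\<integral>\<^sup>+t. ennreal (?w x * ?w y) * (indicator {0..L} t * ennreal ((g (?z t) \<bullet> ?z' t)\<^sup>2)) \<partial>lborel)"
      by (subst nn_integral_cmult) (auto simp: ac_simps)
    also have "\<dots> = ennreal L * (\<integral>\<^sup>+t. indicator {0..L} t * F (?z t) (?z' t) \<partial>lborel)"
      unfolding F_def gauss_weight_rotate[OF sin_cos_squared_add2]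
      by (intro arg_cong[where f="\<lambda>i. ennreal L * i"] nn_integral_cong)
        (simp add: ennreal_mult less_imp_le[OF gauss_weight_pos] ac_simps)
    finally show ?thesis
      by (simp add: ennreal_mult less_imp_le[OF gauss_weight_pos] ac_simps)
  qed
  have "?lhs \<le> (\<integral>\<^sup>+x. \<integral>\<^sup>+y. ennreal L * (\<integral>\<^sup>+t. indicator {0..L} t *
      F (cos t *\<^sub>R x + sin t *\<^sub>R y) (cos t *\<^sub>R y - sin t *\<^sub>R x) \<partial>lborel) \<partial>lborel \<partial>lborel)"
    by (intro nn_integral_mono path)
  also have "\<dots> = ennreal L * (\<integral>\<^sup>+x. \<integral>\<^sup>+y. \<integral>\<^sup>+t. indicator {0..L} t *
      F (cos t *\<^sub>R x + sin t *\<^sub>R y) (cos t *\<^sub>R y - sin t *\<^sub>R x) \<partial>lborel \<partial>lborel \<partial>lborel)"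
    by (simp add: nn_integral_cmult)
  also have "(\<integral>\<^sup>+x. \<integral>\<^sup>+y. \<integral>\<^sup>+t. indicator {0..L} t *
      F (cos t *\<^sub>R x + sin t *\<^sub>R y) (cos t *\<^sub>R y - sin t *\<^sub>R x) \<partial>lborel \<partial>lborel \<partial>lborel) =
    (\<integral>\<^sup>+x. \<integral>\<^sup>+t. \<integral>\<^sup>+y. indicator {0..L} t *
      F (cos t *\<^sub>R x + sin t *\<^sub>R y) (cos t *\<^sub>R y - sin t *\<^sub>R x) \<partial>lborel \<partial>lborel \<partial>lborel)"
    by (intro nn_integral_cong lborel_pair.Fubini') measurable
  also have "\<dots> = (\<integral>\<^sup>+t. \<integral>\<^sup>+x. \<integral>\<^sup>+y. indicator {0..L} t *
      F (cos t *\<^sub>R x + sin t *\<^sub>R y) (cos t *\<^sub>R y - sin t *\<^sub>R x) \<partial>lborel \<partial>lborel \<partial>lborel)"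
    by (rule lborel_pair.Fubini') measurable
  also have "\<dots> = (\<integral>\<^sup>+t. indicator {0..L} t * (\<integral>\<^sup>+x. \<integral>\<^sup>+y. F x y \<partial>lborel \<partial>lborel) \<partial>lborel)"
  proof (rule nn_integral_cong, goal_cases)
    case (1 t)
    have "(\<integral>\<^sup>+x. \<integral>\<^sup>+y. F (cos t *\<^sub>R x + sin t *\<^sub>R y) (cos t *\<^sub>R y - sin t *\<^sub>R x) \<partial>lborel \<partial>lborel) =
      (\<integral>\<^sup>+x. \<integral>\<^sup>+y. F x y \<partial>lborel \<partial>lborel)" if "t \<in> {0..L}"
    proof (cases "t = 0")
      case False
      then show ?thesis
        using that by (intro nn_integral_rotate) (auto intro!: sin_gt_zero simp: L_def)
    qed simp
    then show ?case by (auto simp: nn_integral_cmult split: split_indicator)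
  qed
  also have "\<dots> = ennreal L * (\<integral>\<^sup>+x. \<integral>\<^sup>+y. F x y \<partial>lborel \<partial>lborel)"
    using L by (simp add: nn_integral_multc)
  also have "(\<integral>\<^sup>+x. \<integral>\<^sup>+y. F x y \<partial>lborel \<partial>lborel) \<le>
      (\<integral>\<^sup>+x. \<integral>\<^sup>+y. ennreal ((norm (g x))\<^sup>2 * ?w x) * ennreal ((norm y)\<^sup>2 * ?w y) \<partial>lborel \<partial>lborel)"
  proof (intro nn_integral_mono)
    fix x y :: 'a
    have "(g x \<bullet> y)\<^sup>2 \<le> (norm (g x))\<^sup>2 * (norm y)\<^sup>2"
      using Cauchy_Schwarz_ineq[of "g x" y] by (simp add: power2_norm_eq_inner)
    then have "(g x \<bullet> y)\<^sup>2 * (?w x * ?w y) \<le> (norm (g x))\<^sup>2 * (norm y)\<^sup>2 * (?w x * ?w y)"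
      by (intro mult_right_mono) (simp_all add: less_imp_le gauss_weight_pos)
    then show "F x y \<le> ennreal ((norm (g x))\<^sup>2 * ?w x) * ennreal ((norm y)\<^sup>2 * ?w y)"
      unfolding F_def by (subst ennreal_mult[symmetric])
        (auto intro!: ennreal_leI simp: less_imp_le gauss_weight_pos ac_simps)
  qed
  also have "\<dots> = ?G * gauss_second_moment TYPE('a) \<alpha>"
    unfolding gauss_second_moment_def by (simp add: nn_integral_cmult nn_integral_multc)
  finally have "?lhs \<le> ennreal L * (ennreal L * (?G * gauss_second_moment TYPE('a) \<alpha>))"
    by (simp add: mult_left_mono)
  also have "\<dots> = ennreal (L * L) * (?G * gauss_second_moment TYPE('a) \<alpha>)"
    using L by (simp add: ennreal_mult mult.assoc)
  also have "L * L = pi\<^sup>2 / 4" by (simp add: L_def power2_eq_square)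
  finally show ?thesis .
qed

text \<open>
  The average over \<open>x\<close> of the squared distance from \<open>W\<close> to the constant \<open>W x\<close> is at least the squared
  distance to the best constant; the number \<open>q\<close> stands for a lower bound of the latter, so that
  no mean value has to be formed.
\<close>

theorem gaussian_poincare:
  "\<exists>K>0. \<forall>\<alpha>>0. \<forall>(W :: 'a::euclidean_space \<Rightarrow> real) g q.
     (\<forall>x. GDERIV W x :> g x) \<longrightarrow> continuous_on UNIV g \<longrightarrow>
     (\<forall>c. q \<le> (\<integral>\<^sup>+x. ennreal ((W x - c)\<^sup>2 * gauss_weight \<alpha> x) \<partial>lborel)) \<longrightarrow>
     ennreal \<alpha> * q \<le> ennreal K * (\<integral>\<^sup>+x. ennreal ((norm (g x))\<^sup>2 * gauss_weight \<alpha> x) \<partial>lborel)"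
proof -
  let ?Z = "gauss_mass TYPE('a)" and ?M = "gauss_second_moment TYPE('a)"
  obtain z where z: "?Z 1 = ennreal z" "z > 0"
    using gauss_mass_finite[where 'a='a] gauss_mass_pos[where 'a='a]
    by (cases "?Z 1") auto
  obtain m where m: "?M 1 = ennreal m" "m \<ge> 0"
    using gauss_second_moment_finite[where 'a='a] by (cases "?M 1") auto
  \<comment> \<open>The summand 1 only serves to keep the constant positive.\<close>
  define K where "K = pi\<^sup>2 / 4 * m / z + 1"
  have K: "K > 0" using z m by (simp add: K_def add_nonneg_pos)
  show ?thesis
  proof (intro exI[of _ K] conjI K allI impI)
    fix \<alpha> :: real and W :: "'a \<Rightarrow> real" and g q
    assume \<alpha>: "\<alpha> > 0" and g: "\<forall>x. GDERIV W x :> g x" and cont: "continuous_on UNIV g"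
      and q: "\<forall>c. q \<le> (\<integral>\<^sup>+x. ennreal ((W x - c)\<^sup>2 * gauss_weight \<alpha> x) \<partial>lborel)"
    let ?w = "gauss_weight \<alpha> :: 'a \<Rightarrow> real"
    let ?G = "\<integral>\<^sup>+x. ennreal ((norm (g x))\<^sup>2 * ?w x) \<partial>lborel"
    define r where "r = (1 / sqrt \<alpha>) ^ DIM('a)"
    have r: "r > 0" using \<alpha> by (simp add: r_def)
    have [measurable]: "W \<in> borel_measurable borel"
      using GDERIV_imp_continuous_on[of W g] g by (auto intro: borel_measurable_continuous_onI)
    have "q * ?Z \<alpha> = (\<integral>\<^sup>+x. q * ennreal (?w x) \<partial>lborel)"
      unfolding gauss_mass_def by (simp add: nn_integral_cmult)
    also have "\<dots> \<le> (\<integral>\<^sup>+x. (\<integral>\<^sup>+y. ennreal ((W y - W x)\<^sup>2 * ?w y) \<partial>lborel) * ennreal (?w x) \<partial>lborel)"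
      using q by (intro nn_integral_mono mult_right_mono) auto
    also have "\<dots> = (\<integral>\<^sup>+x. \<integral>\<^sup>+y. ennreal ((W y - W x)\<^sup>2 * (?w x * ?w y)) \<partial>lborel \<partial>lborel)"
      by (intro nn_integral_cong, subst nn_integral_multc[symmetric])
        (auto simp: ennreal_mult less_imp_le gauss_weight_pos ac_simps)
    also have "\<dots> \<le> ennreal (pi\<^sup>2 / 4) * (?G * ?M \<alpha>)"
      using g cont by (intro pair_difference_energy) auto
    finally have "ennreal \<alpha> * (q * ?Z \<alpha>) \<le> ennreal \<alpha> * (ennreal (pi\<^sup>2 / 4) * (?G * ?M \<alpha>))"
      by (rule mult_left_mono) simp
    also have "\<dots> = ennreal (pi\<^sup>2 / 4) * ?G * (ennreal \<alpha> * ?M \<alpha>)"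
      by (simp add: ac_simps)
    also have "\<dots> = ennreal (pi\<^sup>2 / 4) * ?G * (ennreal r * ennreal m)"
      unfolding gauss_second_moment_scale[OF \<alpha>] m r_def ..
    also have "\<dots> = ennreal (pi\<^sup>2 / 4 * m * r) * ?G"
    proof -
      have *: "ennreal (p * m * r) = ennreal p * ennreal m * ennreal r" if "p \<ge> 0" for p
        using that m r by (simp add: ennreal_mult)
      have "ennreal (pi\<^sup>2 / 4 * m * r) = ennreal (pi\<^sup>2 / 4) * ennreal m * ennreal r"
        by (rule *) simp
      then show ?thesis by (simp only: ac_simps)
    qed
    finally have "(ennreal \<alpha> * q) * ennreal (r * z) \<le> ennreal (pi\<^sup>2 / 4 * m * r) * ?G"
      using r z unfolding gauss_mass_scale[OF \<alpha>] r_def[symmetric] z by (simp add: ennreal_mult ac_simps)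
    then have "(ennreal \<alpha> * q) * ennreal (r * z) * ennreal (1 / (r * z)) \<le> ennreal (pi\<^sup>2 / 4 * m * r) * ?G * ennreal (1 / (r * z))"
      by (rule mult_right_mono) simp
    also have "(ennreal \<alpha> * q) * ennreal (r * z) * ennreal (1 / (r * z)) = ennreal \<alpha> * q"
      using r z by (simp add: mult.assoc ennreal_mult[symmetric])
    also have "ennreal (pi\<^sup>2 / 4 * m * r) * ?G * ennreal (1 / (r * z)) = ennreal (pi\<^sup>2 / 4 * m / z) * ?G"
    proof -
      have "ennreal (pi\<^sup>2 / 4 * m * r) * ennreal (1 / (r * z)) = ennreal (pi\<^sup>2 / 4 * m / z)"
        using r z m by (subst ennreal_mult[symmetric]) (simp_all add: field_simps)
      moreover have "a * G * b = (a * b) * G" for a b G :: ennreal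
        by (simp add: ac_simps)
      ultimately show ?thesis by (rule trans[rotated, OF arg_cong[where f="\<lambda>i. i * ?G"]])
    qed
    also have "\<dots> \<le> ennreal K * ?G"
      by (intro mult_right_mono ennreal_leI) (simp_all add: K_def)
    finally show "ennreal \<alpha> * q \<le> ennreal K * ?G" .
  qed
qed

section \<open>Continuously differentiable functions supported in an annulus\<close>

text \<open>
  The class of functions in which the proof takes place: it contains the test functions, and is
  closed under multiplication by radial weights that are singular at the origin and under
  composition with radial power maps. The gradient is carried along as an explicit function, so
  that no choice of derivative has to be unfolded.
\<close>

definition annular_C1 :: "('a::euclidean_space \<Rightarrow> real) \<Rightarrow> ('a \<Rightarrow> 'a) \<Rightarrow> bool" where
  "annular_C1 u g \<longleftrightarrow> (\<forall>x. GDERIV u x :> g x) \<and> continuous_on UNIV g \<and>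
     (\<exists>d>0. \<exists>R. \<forall>x. u x \<noteq> 0 \<longrightarrow> d \<le> norm x \<and> norm x \<le> R)"

lemma GDERIV_unique:
  assumes "GDERIV u x :> D" "GDERIV u x :> E"
  shows "D = E"
proof -
  have "(\<lambda>h. h \<bullet> D) = (\<lambda>h. h \<bullet> E)"
    using assms unfolding gderiv_def by (rule has_derivative_unique)
  from fun_cong[OF this, of "D - E"] have "(D - E) \<bullet> (D - E) = 0"
    by (simp add: inner_diff_right)
  then show ?thesis by simp
qed

lemma GDERIV_zero_on_open:
  assumes "open S" "x \<in> S" "\<And>y. y \<in> S \<Longrightarrow> u y = 0"
  shows "GDERIV u x :> 0"
  unfolding gderiv_def
  by (rule has_derivative_transform_within_open[of "\<lambda>_. 0", OF _ assms(1,2)]) (simp_all add: assms(3))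

lemma annular_gradient_support:
  assumes g: "\<And>x. GDERIV u x :> g x"
    and supp: "\<And>x. u x \<noteq> 0 \<Longrightarrow> d \<le> norm x \<and> norm x \<le> R"
    and "g x \<noteq> 0"
  shows "d \<le> norm x \<and> norm x \<le> R"
proof (rule ccontr)
  assume *: "\<not> ?thesis"
  let ?S = "{y. norm y < d \<or> norm y > R}"
  have "GDERIV u x :> 0"
  proof (rule GDERIV_zero_on_open)
    show "open ?S"
      by (intro open_Collect_disj open_Collect_less continuous_intros)
    show "u y = 0" if "y \<in> ?S" for y
      using that supp[of y] by (cases "u y = 0") auto
  qed (use * in auto)
  then show False using GDERIV_unique g \<open>g x \<noteq> 0\<close> by blast
qed

lemma annular_C1_cases:
  assumes "annular_C1 u g"
  obtains d R where "d > 0" "\<And>x. u x \<noteq> 0 \<Longrightarrow> d \<le> norm x \<and> norm x \<le> R"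
    "\<And>x. g x \<noteq> 0 \<Longrightarrow> d \<le> norm x \<and> norm x \<le> R"
proof -
  have g: "GDERIV u x :> g x" for x
    using assms by (simp add: annular_C1_def)
  have "\<exists>d>0. \<exists>R. \<forall>x. u x \<noteq> 0 \<longrightarrow> d \<le> norm x \<and> norm x \<le> R"
    using assms by (simp only: annular_C1_def)
  then obtain d R where d: "d > 0" and *: "\<forall>x. u x \<noteq> 0 \<longrightarrow> d \<le> norm x \<and> norm x \<le> R"
    by (elim exE conjE)
  have R: "d \<le> norm x \<and> norm x \<le> R" if "u x \<noteq> 0" for x
    using * that by simp
  have R': "d \<le> norm x \<and> norm x \<le> R" if "g x \<noteq> 0" for x
    by (rule annular_gradient_support[of u g d R x, OF g R that])
  show ?thesis
    by (rule that[of d R, OF d R R'])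
qed

lemma annular_C1_zero:
  assumes "annular_C1 u g"
  shows "u 0 = 0" "g 0 = 0"
proof -
  obtain d R where d: "d > 0" and R: "\<And>x. u x \<noteq> 0 \<Longrightarrow> d \<le> norm x \<and> norm x \<le> R"
    "\<And>x. g x \<noteq> 0 \<Longrightarrow> d \<le> norm x \<and> norm x \<le> R"
    using annular_C1_cases[OF assms] by metis
  show "u 0 = 0" "g 0 = 0"
    using R[of 0] d by (auto simp del: norm_le_zero_iff)
qed

lemma annular_C1_continuous:
  assumes "annular_C1 u g"
  shows "continuous_on S u" "continuous_on S g"
proof -
  have "continuous_on UNIV u"
    by (rule GDERIV_imp_continuous_on[of u g]) (use assms in \<open>simp add: annular_C1_def\<close>)
  then show "continuous_on S u" by (rule continuous_on_subset) simp
  have "continuous_on UNIV g" using assms by (simp add: annular_C1_def)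
  then show "continuous_on S g" by (rule continuous_on_subset) simp
qed

lemma annular_C1_measurable:
  assumes "annular_C1 u g"
  shows "u \<in> borel_measurable borel" "g \<in> borel_measurable borel"
  using annular_C1_continuous[OF assms] by (auto intro: borel_measurable_continuous_onI)

lemma annular_integrable:
  fixes h :: "'a::euclidean_space \<Rightarrow> real"
  assumes "continuous_on (UNIV - {0}) h" and "d > 0"
    and supp: "\<And>x. h x \<noteq> 0 \<Longrightarrow> d \<le> norm x \<and> norm x \<le> R"
  shows "integrable lborel h"
proof -
  let ?K = "cball 0 R - ball 0 d :: 'a set"
  have "integrable lborel (\<lambda>x. indicator ?K x *\<^sub>R h x)"
  proof (rule borel_integrable_compact)
    show "compact ?K" by (intro compact_diff) auto
    show "continuous_on ?K h"
      using assms(1) by (rule continuous_on_subset) (use \<open>d > 0\<close> in auto)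
  qed
  moreover have "(\<lambda>x. indicator ?K x *\<^sub>R h x) = h"
  proof
    show "indicator ?K x *\<^sub>R h x = h x" for x
      using supp[of x] by (cases "h x = 0") (auto split: split_indicator)
  qed
  ultimately show ?thesis by (simp only:)
qed

lemma continuous_on_extend_by_zero:
  fixes h :: "'a::real_normed_vector \<Rightarrow> 'b::real_normed_vector"
  assumes "continuous_on (UNIV - {0}) h" "d > 0" "\<And>x. norm x < d \<Longrightarrow> h x = 0"
  shows "continuous_on UNIV h"
proof -
  have "continuous_on (ball 0 d) h"
    by (rule continuous_on_cong[THEN iffD1, OF refl _ continuous_on_const[of _ 0]]) (simp add: assms(3))
  then have "continuous_on ((UNIV - {0}) \<union> ball 0 d) h"
    using assms(1) by (intro continuous_on_open_Un) auto
  moreover have "(UNIV - {0}) \<union> ball 0 d = (UNIV :: 'a set)"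
    using \<open>d > 0\<close> by auto
  ultimately show ?thesis by simp
qed

lemma annular_C1_mult:
  assumes u: "annular_C1 u g"
    and v: "\<And>x. x \<noteq> 0 \<Longrightarrow> GDERIV v x :> k x" "continuous_on (UNIV - {0}) k"
  shows "annular_C1 (\<lambda>x. u x * v x) (\<lambda>x. u x *\<^sub>R k x + v x *\<^sub>R g x)"
proof -
  obtain d R where d: "d > 0" and R: "\<And>x. u x \<noteq> 0 \<Longrightarrow> d \<le> norm x \<and> norm x \<le> R"
    "\<And>x. g x \<noteq> 0 \<Longrightarrow> d \<le> norm x \<and> norm x \<le> R"
    using annular_C1_cases[OF u] by metis
  have v_cont: "continuous_on (UNIV - {0}) v"
    using v(1) unfolding gderiv_def
    by (intro has_derivative_continuous_on) (auto intro: has_derivative_at_withinI)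
  show ?thesis
    unfolding annular_C1_def
  proof (intro conjI allI)
    show "GDERIV (\<lambda>x. u x * v x) x :> u x *\<^sub>R k x + v x *\<^sub>R g x" for x
    proof (cases "x = 0")
      case True
      have "GDERIV (\<lambda>x. u x * v x) x :> 0"
        by (rule GDERIV_zero_on_open[of "ball 0 d"]) (use True d R in force)+
      then show ?thesis using True annular_C1_zero[OF u] by simp
    next
      case False
      then show ?thesis
        using u v(1) by (intro GDERIV_mult) (auto simp: annular_C1_def)
    qed
    show "continuous_on UNIV (\<lambda>x. u x *\<^sub>R k x + v x *\<^sub>R g x)"
    proof (rule continuous_on_extend_by_zero[OF _ d])
      show "u x *\<^sub>R k x + v x *\<^sub>R g x = 0" if "norm x < d" for x
        using R[of x] that by fastforce
    qed (intro continuous_intros annular_C1_continuous[OF u] v v_cont)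
    show "\<exists>d>0. \<exists>R. \<forall>x. u x * v x \<noteq> 0 \<longrightarrow> d \<le> norm x \<and> norm x \<le> R"
      using d R by auto
  qed
qed

lemma GDERIV_radial:
  assumes "x \<noteq> 0" and f: "(f has_real_derivative f') (at (norm x))"
  shows "GDERIV (\<lambda>x. f (norm x)) x :> (f' / norm x) *\<^sub>R x"
  using GDERIV_DERIV_compose[OF GDERIV_norm[OF assms(1)] f]
  by (simp add: sgn_div_norm divide_inverse)

lemma annular_C1_mult_radial:
  fixes u :: "'a::euclidean_space \<Rightarrow> real"
  assumes u: "annular_C1 u g"
    and f: "\<And>t. t > 0 \<Longrightarrow> (f has_real_derivative f' t) (at t)" and f': "continuous_on {0<..} f'"
  shows "annular_C1 (\<lambda>x. u x * f (norm x))
    (\<lambda>x. u x *\<^sub>R (f' (norm x) / norm x) *\<^sub>R x + f (norm x) *\<^sub>R g x)"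
proof (rule annular_C1_mult[OF u])
  show "GDERIV (\<lambda>x. f (norm x)) x :> (f' (norm x) / norm x) *\<^sub>R x" if "x \<noteq> 0" for x :: 'a
    using that by (intro GDERIV_radial f) auto
  show "continuous_on (UNIV - {0}) (\<lambda>x::'a. (f' (norm x) / norm x) *\<^sub>R x)"
    by (intro continuous_intros continuous_on_compose2[OF f']) auto
qed

text \<open>
  With \<open>S y = norm y powr m *\<^sub>R y\<close>, the derivative of \<open>S\<close> at \<open>y\<close> stretches tangential directions by
  \<open>norm y powr m\<close> and the radial one by \<open>(1 + m) * norm y powr m\<close>. As \<open>m \<ge> 0\<close> the radial stretching
  is the larger one and bounds the gradient of the composition.
\<close>

lemma annular_C1_pull_back_power:
  fixes f :: "'a::euclidean_space \<Rightarrow> real"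
  assumes f: "annular_C1 f k" and m: "m \<ge> 0"
  obtains g where "annular_C1 (\<lambda>y. f (norm y powr m *\<^sub>R y)) g"
    "\<And>y. norm (g y) \<le> (1 + m) * norm y powr m * norm (k (norm y powr m *\<^sub>R y))"
proof -
  obtain d R where d: "d > 0" and R: "\<And>x. f x \<noteq> 0 \<Longrightarrow> d \<le> norm x \<and> norm x \<le> R"
    "\<And>x. k x \<noteq> 0 \<Longrightarrow> d \<le> norm x \<and> norm x \<le> R"
    using annular_C1_cases[OF f] by metis
  define S where "S y = norm y powr m *\<^sub>R y" for y :: 'a
  have norm_S: "norm (S y) = norm y powr (1 + m)" for y
    by (cases "y = 0") (simp_all add: S_def powr_add)
  have S_cont: "continuous_on (UNIV - {0}) S"
    unfolding S_def by (intro continuous_intros) auto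
  define g where "g y = norm y powr m *\<^sub>R k (S y) + (m * norm y powr (m - 2) * (y \<bullet> k (S y))) *\<^sub>R y" for y
  define d' where "d' = d powr (1 / (1 + m))"
  define R' where "R' = max R 0 powr (1 / (1 + m))"
  have d': "d' > 0" using d by (simp add: d'_def)
  have range: "d' \<le> norm y \<and> norm y \<le> R'" if "d \<le> norm (S y) \<and> norm (S y) \<le> R" for y
  proof -
    have y: "norm y = norm (S y) powr (1 / (1 + m))"
      using m by (simp add: norm_S powr_powr)
    show ?thesis unfolding d'_def R'_def y
      using that d m by (intro conjI powr_mono2) auto
  qed
  have "annular_C1 (\<lambda>y. f (S y)) g"
    unfolding annular_C1_def
  proof (intro conjI allI)
    show "GDERIV (\<lambda>y. f (S y)) y :> g y" for y
    proof (cases "y = 0")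
      case True
      have "GDERIV (\<lambda>y. f (S y)) y :> 0"
      proof (rule GDERIV_zero_on_open[of "ball 0 d'"])
        show "f (S z) = 0" if "z \<in> ball 0 d'" for z
          using that range[of z] R(1)[of "S z"] by (cases "f (S z) = 0") auto
      qed (use True d' in auto)
      moreover have "g y = 0" using True annular_C1_zero[OF f] by (simp add: g_def)
      ultimately show ?thesis by simp
    next
      case False
      have "GDERIV (\<lambda>x. norm x powr m) y :> (m * norm y powr (m - 1) / norm y) *\<^sub>R y"
        using False by (intro GDERIV_radial has_real_derivative_powr) auto
      then have "(S has_derivative (\<lambda>h. norm y powr m *\<^sub>R h + (h \<bullet> ((m * norm y powr (m - 1) / norm y) *\<^sub>R y)) *\<^sub>R y)) (at y)"
        unfolding S_def gderiv_def by (rule has_derivative_scaleR[OF _ has_derivative_ident])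
      moreover have "(f has_derivative (\<lambda>h. h \<bullet> k (S y))) (at (S y))"
        using f by (simp add: annular_C1_def gderiv_def)
      ultimately have "((\<lambda>y. f (S y)) has_derivative
         (\<lambda>h. (norm y powr m *\<^sub>R h + (h \<bullet> ((m * norm y powr (m - 1) / norm y) *\<^sub>R y)) *\<^sub>R y) \<bullet> k (S y))) (at y)"
        by (rule has_derivative_compose)
      moreover have "norm y powr (m - 1) / norm y = norm y powr (m - 2)"
      proof -
        have "norm y powr (m - 1) = norm y powr (m - 2) * norm y powr 1"
          by (subst powr_add[symmetric]) simp
        then show ?thesis using False by simp
      qed
      then have "m * norm y powr (m - 1) / norm y = m * norm y powr (m - 2)"
        by (metis times_divide_eq_right)
      ultimately show ?thesis
        unfolding gderiv_def g_def
        by (elim has_derivative_eq_rhs) (simp add: fun_eq_iff inner_add_left inner_add_right algebra_simps)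
    qed
    show "continuous_on UNIV g"
    proof (rule continuous_on_extend_by_zero[OF _ d'])
      have "continuous_on (UNIV - {0}) (\<lambda>y. k (S y))"
        by (rule continuous_on_compose2[OF annular_C1_continuous(2)[OF f, of UNIV] S_cont]) simp
      then show "continuous_on (UNIV - {0}) g"
        unfolding g_def by (intro continuous_intros) auto
      show "g y = 0" if "norm y < d'" for y
        using that range[of y] R(2)[of "S y"] by (cases "k (S y) = 0") (auto simp: g_def)
    qed
    show "\<exists>d>0. \<exists>R. \<forall>y. f (S y) \<noteq> 0 \<longrightarrow> d \<le> norm y \<and> norm y \<le> R"
      using d' range R(1) by blast
  qed
  moreover have "norm (g y) \<le> (1 + m) * norm y powr m * norm (k (S y))" for y
  proof (cases "y = 0")
    case False
    have "norm (g y) \<le> norm (norm y powr m *\<^sub>R k (S y)) + norm ((m * norm y powr (m - 2) * (y \<bullet> k (S y))) *\<^sub>R y)"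
      unfolding g_def by (rule norm_triangle_ineq)
    also have "\<dots> = norm y powr m * norm (k (S y)) + m * norm y powr (m - 2) * (\<bar>y \<bullet> k (S y)\<bar> * norm y)"
      using m by (simp add: abs_mult)
    also have "\<dots> \<le> norm y powr m * norm (k (S y)) + m * norm y powr (m - 2) * ((norm y * norm (k (S y))) * norm y)"
      using m by (intro add_left_mono mult_left_mono mult_right_mono Cauchy_Schwarz_ineq2) auto
    also have "m * norm y powr (m - 2) * ((norm y * norm (k (S y))) * norm y) =
        m * (norm y powr (m - 2) * (norm y)\<^sup>2) * norm (k (S y))"
      by (simp add: power2_eq_square)
    also have "norm y powr (m - 2) * (norm y)\<^sup>2 = norm y powr m"
      using False by (simp add: powr_diff)
    finally show ?thesis by (simp add: algebra_simps)
  qed (use annular_C1_zero[OF f] in \<open>simp add: g_def S_def\<close>)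
  ultimately show ?thesis using that unfolding S_def by blast
qed

lemma test_function_annular_C1:
  assumes u: "u \<in> test_functions (UNIV - {0 :: 'a::euclidean_space})"
  shows "annular_C1 u (gradient u)"
proof -
  let ?K = "closure {x. u x \<noteq> 0}"
  have comp: "compact ?K" and sub: "0 \<notin> ?K" and sm: "C_k_on (Suc 0) (UNIV - {0}) u"
    using u by (auto simp: test_functions_def smooth_on_def)
  obtain d where d: "d > 0" "\<And>x. x \<in> ?K \<Longrightarrow> d \<le> norm x"
    using separate_point_closed[of ?K 0] sub by (auto simp: dist_norm)
  obtain R where R: "\<And>x. x \<in> ?K \<Longrightarrow> norm x \<le> R"
    using compact_imp_bounded[OF comp] by (meson bounded_iff)
  have supp: "d \<le> norm x \<and> norm x \<le> R" if "u x \<noteq> 0" for x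
    using that closure_subset[of "{x. u x \<noteq> 0}"] d(2) R by blast
  have near0: "u x = 0" if "norm x < d" for x
    using supp[of x] that by (cases "u x = 0") auto
  have grad_eq: "gradient u x = D" if "GDERIV u x :> D" for x D
    unfolding gradient_def using that GDERIV_unique by blast
  have near0': "GDERIV u x :> 0" if "norm x < d" for x
    by (rule GDERIV_zero_on_open[of "ball 0 d"]) (use that near0 in auto)
  let ?F = "\<lambda>x. \<Sum>i\<in>Basis. frechet_derivative u (at x) i *\<^sub>R i"
  have F: "GDERIV u x :> ?F x" if "x \<noteq> 0" for x
  proof -
    have der: "(u has_derivative frechet_derivative u (at x)) (at x)"
      using sm that by (simp add: frechet_derivative_works)
    then interpret linear "frechet_derivative u (at x)"
      by (rule has_derivative_linear)
    have "frechet_derivative u (at x) h = h \<bullet> ?F x" for h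
    proof -
      have "frechet_derivative u (at x) h = frechet_derivative u (at x) (\<Sum>i\<in>Basis. (h \<bullet> i) *\<^sub>R i)"
        by (simp add: euclidean_representation)
      also have "\<dots> = h \<bullet> ?F x"
        by (simp add: sum scale inner_sum_right mult.commute)
      finally show ?thesis .
    qed
    then have "frechet_derivative u (at x) = (\<lambda>h. h \<bullet> ?F x)" by (rule ext)
    with der show ?thesis by (simp add: gderiv_def)
  qed
  have G: "GDERIV u x :> gradient u x" for x
  proof (cases "x = 0")
    case True
    then show ?thesis using near0'[of x] grad_eq[OF near0'[of x]] d(1) by simp
  next
    case False
    show ?thesis using F[OF False] grad_eq[OF F[OF False]] by simp
  qed
  have "continuous_on UNIV (gradient u)"
  proof (rule continuous_on_extend_by_zero[OF _ d(1)])
    have "continuous_on (UNIV - {0}) ?F"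
      using sm by (intro continuous_intros) auto
    then show "continuous_on (UNIV - {0}) (gradient u)"
      by (rule continuous_on_cong[THEN iffD1, rotated 2]) (use grad_eq[OF F] in auto)
    show "gradient u x = 0" if "norm x < d" for x
      by (rule grad_eq[OF near0'[OF that]])
  qed
  then show ?thesis unfolding annular_C1_def using G d(1) supp by blast
qed

section \<open>Integration by parts against powers of the norm\<close>

lemma integral_lborel_scale:
  fixes h :: "'a::euclidean_space \<Rightarrow> real"
  assumes [measurable]: "h \<in> borel_measurable borel" and c: "c > 0"
  shows "(\<integral>x. h x \<partial>lborel) = c ^ DIM('a) * (\<integral>x. h (c *\<^sub>R x) \<partial>lborel)"
proof -
  have "(\<integral>x. h x \<partial>lborel) =
      (\<integral>x. h x \<partial>density (distr lborel borel (\<lambda>x. 0 + c *\<^sub>R x)) (\<lambda>_. \<bar>c\<bar> ^ DIM('a)))"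
    using c by (subst lborel_affine[of c 0]) simp_all
  also have "\<dots> = c ^ DIM('a) * (\<integral>x. h (c *\<^sub>R x) \<partial>lborel)"
    using c by (subst integral_density) (simp_all add: integral_distr)
  finally show ?thesis .
qed

text \<open>
  The divergence theorem for the field \<open>h x *\<^sub>R x\<close>, obtained by differentiating the scaling identity
  \<open>\<integral> h (t *\<^sub>R x) = (\<integral> h x) / t ^ DIM('a)\<close> at \<open>t = 1\<close>. Difference quotients are dominated because \<open>h\<close> is
  Lipschitz with bounded support.
\<close>

lemma euler_identity:
  fixes h :: "'a::euclidean_space \<Rightarrow> real"
  assumes h: "annular_C1 h k"
  shows "(\<integral>x. k x \<bullet> x \<partial>lborel) = - real DIM('a) * (\<integral>x. h x \<partial>lborel)"
proof -
  obtain d R where d: "d > 0" and R: "\<And>x. h x \<noteq> 0 \<Longrightarrow> d \<le> norm x \<and> norm x \<le> R"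
    "\<And>x. k x \<noteq> 0 \<Longrightarrow> d \<le> norm x \<and> norm x \<le> R"
    using annular_C1_cases[OF h] by metis
  note [measurable] = annular_C1_measurable[OF h]
  have hder: "(h has_derivative (\<lambda>v. v \<bullet> k x)) (at x)" for x
    using h by (simp add: annular_C1_def gderiv_def)
  have h_int: "integrable lborel h"
    by (rule annular_integrable[OF annular_C1_continuous(1)[OF h] d R(1)])
  obtain B where B: "B \<ge> 0" "\<And>x. norm (k x) \<le> B"
  proof -
    have "compact (k ` cball 0 R)"
      by (intro compact_continuous_image annular_C1_continuous[OF h] compact_cball)
    then obtain B where "\<And>x. x \<in> cball 0 R \<Longrightarrow> norm (k x) \<le> B"
      by (meson bounded_iff compact_imp_bounded imageI)
    then have "norm (k x) \<le> max B 0" for x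
      using R(2)[of x] by (cases "k x = 0") (auto simp: le_max_iff_disj)
    then show ?thesis by (intro that[of "max B 0"]) auto
  qed
  have lip: "\<bar>h y - h x\<bar> \<le> B * norm (y - x)" for x y
  proof -
    have "norm (h y - h x) \<le> B * norm (y - x)"
    proof (rule differentiable_bound[of UNIV])
      show "onorm (\<lambda>v. v \<bullet> k z) \<le> B" for z
      proof (rule onorm_le)
        fix v
        have "norm (v \<bullet> k z) \<le> norm v * norm (k z)" by (simp add: Cauchy_Schwarz_ineq2)
        also have "\<dots> \<le> norm v * B" by (intro mult_left_mono B) auto
        finally show "norm (v \<bullet> k z) \<le> B * norm v" by (simp add: mult.commute)
      qed
    qed (auto intro: hder)
    then show ?thesis by simp
  qed
  define e :: "nat \<Rightarrow> real" where "e n = 1 / real (Suc n)" for n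
  have e: "e n > 0" "e n \<le> 1" for n by (auto simp: e_def)
  have e_lim: "filterlim e (at 0) sequentially"
  proof -
    have "e \<longlonglongrightarrow> 0"
      unfolding e_def by (rule LIMSEQ_Suc[OF lim_1_over_n])
    then show ?thesis
      using e(1) by (auto simp: filterlim_at intro!: always_eventually less_imp_neq[symmetric])
  qed
  define D where "D n x = (h ((1 + e n) *\<^sub>R x) - h x) / e n" for n x
  have "(\<lambda>n. \<integral>x. D n x \<partial>lborel) \<longlonglongrightarrow> (\<integral>x. k x \<bullet> x \<partial>lborel)"
  proof (rule integral_dominated_convergence[where w="\<lambda>x. indicator (cball 0 R) x *\<^sub>R (B * norm x)"])
    show "integrable lborel (\<lambda>x::'a. indicator (cball 0 R) x *\<^sub>R (B * norm x))"
      by (intro borel_integrable_compact continuous_intros compact_cball)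
    show "AE x in lborel. (\<lambda>n. D n x) \<longlonglongrightarrow> k x \<bullet> x"
    proof (intro AE_I2)
      fix x :: 'a
      have "((\<lambda>t. (1 + t) *\<^sub>R x) has_derivative (\<lambda>v. v *\<^sub>R x)) (at 0)"
        by (auto intro!: derivative_eq_intros)
      moreover have "(h has_derivative (\<lambda>v. v \<bullet> k x)) (at ((1 + 0) *\<^sub>R x))"
        using hder[of x] by simp
      ultimately have "((\<lambda>t. h ((1 + t) *\<^sub>R x)) has_derivative (\<lambda>v. (v *\<^sub>R x) \<bullet> k x)) (at 0)"
        by (rule has_derivative_compose)
      then have "((\<lambda>t. h ((1 + t) *\<^sub>R x)) has_real_derivative k x \<bullet> x) (at 0)"
        unfolding has_field_derivative_def
        by (rule has_derivative_eq_rhs) (simp add: fun_eq_iff inner_commute)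
      then have "((\<lambda>t. (h ((1 + t) *\<^sub>R x) - h x) / t) \<longlongrightarrow> k x \<bullet> x) (at 0)"
        by (simp add: DERIV_def)
      from filterlim_compose[OF this e_lim] show "(\<lambda>n. D n x) \<longlonglongrightarrow> k x \<bullet> x"
        by (simp add: D_def)
    qed
    show "AE x in lborel. norm (D n x) \<le> indicator (cball 0 R) x *\<^sub>R (B * norm x)" for n
    proof (intro AE_I2)
      fix x :: 'a
      have "\<bar>D n x\<bar> \<le> B * norm x"
      proof -
        have "(1 + e n) *\<^sub>R x - x = e n *\<^sub>R x" by (simp add: algebra_simps)
        then have "\<bar>h ((1 + e n) *\<^sub>R x) - h x\<bar> \<le> B * (e n * norm x)"
          using lip[of "(1 + e n) *\<^sub>R x" x] e(1)[of n] by simp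
        then show ?thesis using e(1)[of n] by (simp add: D_def field_simps)
      qed
      moreover have "D n x = 0" if "norm x > R"
      proof -
        have "norm x \<le> norm ((1 + e n) *\<^sub>R x)"
          using e(1)[of n] by (simp add: mult_le_cancel_right1)
        then have "h x = 0" "h ((1 + e n) *\<^sub>R x) = 0" using that R(1) by fastforce+
        then show ?thesis by (simp add: D_def)
      qed
      ultimately show "norm (D n x) \<le> indicator (cball 0 R) x *\<^sub>R (B * norm x)"
        by (auto split: split_indicator)
    qed
  qed (auto simp: D_def[abs_def])
  moreover have "(\<lambda>n. \<integral>x. D n x \<partial>lborel) \<longlonglongrightarrow> - real DIM('a) * (\<integral>x. h x \<partial>lborel)"
  proof -
    have "(\<integral>x. D n x \<partial>lborel) = (inverse ((1 + e n) ^ DIM('a)) - 1) / e n * (\<integral>x. h x \<partial>lborel)" for n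
    proof -
      let ?q = "(1 + e n) ^ DIM('a)"
      have pos: "1 + e n > 0" using e(1)[of n] by linarith
      have hs: "integrable lborel (\<lambda>x. h ((1 + e n) *\<^sub>R x))"
      proof (rule annular_integrable)
        show "continuous_on (UNIV - {0}) (\<lambda>x. h ((1 + e n) *\<^sub>R x))"
          by (intro continuous_on_compose2[OF annular_C1_continuous(1)[OF h, of UNIV]] continuous_intros) auto
        show "d / (1 + e n) \<le> norm x \<and> norm x \<le> R / (1 + e n)" if "h ((1 + e n) *\<^sub>R x) \<noteq> 0" for x
        proof -
          have "norm ((1 + e n) *\<^sub>R x) = (1 + e n) * norm x"
            using pos by simp
          then show ?thesis
            using R(1)[OF that] pos by (simp add: pos_divide_le_eq pos_le_divide_eq mult.commute)
        qed
      qed (use d pos in simp)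
      have "(\<integral>x. h x \<partial>lborel) = ?q * (\<integral>x. h ((1 + e n) *\<^sub>R x) \<partial>lborel)"
        using pos by (intro integral_lborel_scale) auto
      then have "(\<integral>x. h ((1 + e n) *\<^sub>R x) \<partial>lborel) = inverse ?q * (\<integral>x. h x \<partial>lborel)"
        using pos by (simp add: field_simps)
      then show ?thesis
        unfolding D_def using hs h_int by (simp add: field_simps diff_divide_distrib)
    qed
    then have D_int: "(\<lambda>n. \<integral>x. D n x \<partial>lborel) =
        (\<lambda>n. (inverse ((1 + e n) ^ DIM('a)) - 1) / e n * (\<integral>x. h x \<partial>lborel))"
      by (rule ext)
    have "((\<lambda>t::real. inverse ((1 + t) ^ DIM('a))) has_real_derivative - real DIM('a)) (at 0)"
      by (auto intro!: derivative_eq_intros)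
    then have "((\<lambda>t::real. (inverse ((1 + t) ^ DIM('a)) - 1) / t) \<longlongrightarrow> - real DIM('a)) (at 0)"
      by (simp add: DERIV_def)
    from filterlim_compose[OF this e_lim] show ?thesis
      unfolding D_int by (rule tendsto_mult_right)
  qed
  ultimately show ?thesis by (rule LIMSEQ_unique)
qed

lemma annular_integrable_mult:
  assumes u: "annular_C1 u g" and w: "continuous_on (UNIV - {0}) w"
  shows "integrable lborel (\<lambda>x. (u x)\<^sup>2 * w x)" "integrable lborel (\<lambda>x. u x * (g x \<bullet> x) * w x)"
    "integrable lborel (\<lambda>x. (norm (g x))\<^sup>2 * w x)"
proof -
  obtain d R where d: "d > 0" and R: "\<And>x. u x \<noteq> 0 \<Longrightarrow> d \<le> norm x \<and> norm x \<le> R"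
    "\<And>x. g x \<noteq> 0 \<Longrightarrow> d \<le> norm x \<and> norm x \<le> R"
    using annular_C1_cases[OF u] by metis
  note cont = continuous_intros annular_C1_continuous[OF u] w
  show "integrable lborel (\<lambda>x. (u x)\<^sup>2 * w x)"
    by (rule annular_integrable[OF _ d]) (auto intro!: cont R(1)[THEN conjunct1] R(1)[THEN conjunct2])
  show "integrable lborel (\<lambda>x. u x * (g x \<bullet> x) * w x)"
    by (rule annular_integrable[OF _ d]) (auto intro!: cont R(1)[THEN conjunct1] R(1)[THEN conjunct2])
  show "integrable lborel (\<lambda>x. (norm (g x))\<^sup>2 * w x)"
    by (rule annular_integrable[OF _ d]) (auto intro!: cont R(2)[THEN conjunct1] R(2)[THEN conjunct2])
qed

lemma continuous_on_norm_powr: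
  "continuous_on (UNIV - {0}) (\<lambda>x::'a::real_normed_vector. norm x powr p)"
  by (intro continuous_intros) auto

lemma radial_integration_by_parts:
  fixes u :: "'a::euclidean_space \<Rightarrow> real"
  assumes u: "annular_C1 u g"
  shows "2 * (\<integral>x. u x * (g x \<bullet> x) * norm x powr p \<partial>lborel) =
    - (real DIM('a) + p) * (\<integral>x. (u x)\<^sup>2 * norm x powr p \<partial>lborel)"
proof -
  have g: "\<And>x. GDERIV u x :> g x" using u by (simp add: annular_C1_def)
  have "annular_C1 (\<lambda>x. u x * u x) (\<lambda>x. u x *\<^sub>R g x + u x *\<^sub>R g x)"
    by (rule annular_C1_mult[OF u]) (auto intro: g annular_C1_continuous[OF u])
  then have "annular_C1 (\<lambda>x. u x * u x * norm x powr p)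
    (\<lambda>x. (u x * u x) *\<^sub>R (p * norm x powr (p - 1) / norm x) *\<^sub>R x + norm x powr p *\<^sub>R (u x *\<^sub>R g x + u x *\<^sub>R g x))"
    by (rule annular_C1_mult_radial)
      (auto intro!: has_real_derivative_powr continuous_intros)
  from euler_identity[OF this]
  have "(\<integral>x. ((u x * u x) *\<^sub>R (p * norm x powr (p - 1) / norm x) *\<^sub>R x + norm x powr p *\<^sub>R (u x *\<^sub>R g x + u x *\<^sub>R g x)) \<bullet> x \<partial>lborel)
    = - real DIM('a) * (\<integral>x. (u x)\<^sup>2 * norm x powr p \<partial>lborel)"
    by (simp add: power2_eq_square)
  also have "(\<lambda>x. ((u x * u x) *\<^sub>R (p * norm x powr (p - 1) / norm x) *\<^sub>R x + norm x powr p *\<^sub>R (u x *\<^sub>R g x + u x *\<^sub>R g x)) \<bullet> x)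
    = (\<lambda>x. p * ((u x)\<^sup>2 * norm x powr p) + 2 * (u x * (g x \<bullet> x) * norm x powr p))"
  proof
    fix x
    show "((u x * u x) *\<^sub>R (p * norm x powr (p - 1) / norm x) *\<^sub>R x + norm x powr p *\<^sub>R (u x *\<^sub>R g x + u x *\<^sub>R g x)) \<bullet> x
      = p * ((u x)\<^sup>2 * norm x powr p) + 2 * (u x * (g x \<bullet> x) * norm x powr p)"
    proof (cases "x = 0")
      case False
      have "norm x powr (p - 1) / norm x * (x \<bullet> x) = norm x powr p"
        using False by (simp add: powr_diff flip: power2_norm_eq_inner) (simp add: power2_eq_square)
      then have e: "p * norm x powr (p - 1) / norm x * (x \<bullet> x) = p * norm x powr p"
        by (metis (no_types, opaque_lifting) mult.assoc times_divide_eq_right)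
      have "((u x * u x) *\<^sub>R A *\<^sub>R x + B *\<^sub>R (u x *\<^sub>R g x + u x *\<^sub>R g x)) \<bullet> x =
          u x * u x * (A * (x \<bullet> x)) + 2 * (u x * (g x \<bullet> x) * B)" for A B
        by (simp add: inner_add_left algebra_simps)
      from this[of "p * norm x powr (p - 1) / norm x" "norm x powr p", unfolded e] show ?thesis
        by (rule trans) (simp add: power2_eq_square)
    qed simp
  qed
  also have "(\<integral>x. p * ((u x)\<^sup>2 * norm x powr p) + 2 * (u x * (g x \<bullet> x) * norm x powr p) \<partial>lborel) =
    p * (\<integral>x. (u x)\<^sup>2 * norm x powr p \<partial>lborel) + 2 * (\<integral>x. u x * (g x \<bullet> x) * norm x powr p \<partial>lborel)"
    using annular_integrable_mult[OF u continuous_on_norm_powr[of p]] by simp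
  finally show ?thesis by (simp add: algebra_simps)
qed

section \<open>Completing the square\<close>

text \<open>
  Let \<open>\<psi>\<close> be the radial function \<open>norm x powr s * exp (- l / \<beta> * norm x powr \<beta>)\<close>. Its gradient at
  \<open>x\<close> is \<open>(\<psi> * \<phi>) *\<^sub>R x\<close>, where \<open>\<phi>\<close> stands for \<open>s / norm x powr 2 - l * norm x powr (\<beta> - 2)\<close>. As
  \<open>f = u / \<psi>\<close>, one has \<open>\<psi> *\<^sub>R \<nabla>f = \<nabla>u - (u * \<phi>) *\<^sub>R x\<close>. When the square of the right hand side is
  expanded, the mixed terms become integrals of \<open>u\<^sup>2\<close> against powers of the norm by integration
  by parts. The exponent \<open>s\<close> is chosen so that the Hardy terms, those with weight
  \<open>norm x powr (- 2 * b - 2)\<close>, cancel.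
\<close>

lemma complete_square:
  fixes u :: "'a::euclidean_space \<Rightarrow> real" and a b l :: real
  assumes u: "annular_C1 u g"
  defines "s \<equiv> 2 * b + 2 - real DIM('a)" and "\<beta> \<equiv> b + 1 - a"
  defines "f \<equiv> \<lambda>x. u x * (norm x powr (- s) * exp (l / \<beta> * norm x powr \<beta>))"
  assumes \<beta>: "\<beta> \<noteq> 0"
  obtains k where "annular_C1 f k" and
    "(\<integral>x. (norm (g x))\<^sup>2 * norm x powr (- 2 * b) \<partial>lborel)
       + l\<^sup>2 * (\<integral>x. (u x)\<^sup>2 * norm x powr (- 2 * a) \<partial>lborel)
       - l * (3 * b - a - real DIM('a) + 3) * (\<integral>x. (u x)\<^sup>2 * norm x powr (- (a + b + 1)) \<partial>lborel) =
     (\<integral>x. (norm (k x))\<^sup>2 * (norm x powr (2 * s - 2 * b) * exp (- (2 * l / \<beta>) * norm x powr \<beta>)) \<partial>lborel)"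
proof -
  define v where "v t = t powr (- s) * exp (l / \<beta> * t powr \<beta>)" for t :: real
  define \<phi> where "\<phi> t = s * t powr (- 2) - l * t powr (\<beta> - 2)" for t :: real
  have dv: "(v has_real_derivative - (v t * (t * \<phi> t))) (at t)" if "t > 0" for t
  proof -
    have "(v has_real_derivative
        t powr (- s) * (exp (l / \<beta> * t powr \<beta>) * (l / \<beta> * (\<beta> * t powr (\<beta> - 1)))) +
        (- s) * t powr (- s - 1) * exp (l / \<beta> * t powr \<beta>)) (at t)"
      unfolding v_def using that
      by (auto intro!: derivative_eq_intros has_real_derivative_powr)
    moreover have "t powr (\<beta> - 1) = t * t powr (\<beta> - 2)" "t powr (- s - 1) = t powr (- s) * (t * t powr (- 2))"
    proof -
      have "t powr (\<beta> - 1) = t powr 1 * t powr (\<beta> - 2)"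
        by (subst powr_add[symmetric]) simp
      then show "t powr (\<beta> - 1) = t * t powr (\<beta> - 2)"
        using that by simp
      have "t powr (- s - 1) = t powr (- s) * (t powr 1 * t powr (- 2))"
        by (subst powr_add[symmetric])+ simp
      then show "t powr (- s - 1) = t powr (- s) * (t * t powr (- 2))"
        using that by simp
    qed
    ultimately show ?thesis
      using \<beta> by (simp add: v_def \<phi>_def algebra_simps)
  qed
  have v_cont: "continuous_on {0<..} (\<lambda>t. - (v t * (t * \<phi> t)))"
    unfolding v_def \<phi>_def by (intro continuous_intros) auto
  define k where "k x = u x *\<^sub>R (- (v (norm x) * (norm x * \<phi> (norm x))) / norm x) *\<^sub>R x + v (norm x) *\<^sub>R g x" for x
  have k: "annular_C1 f k"
    unfolding f_def k_def using annular_C1_mult_radial[OF u dv v_cont] by (simp add: v_def)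
  have k_eq: "k x = v (norm x) *\<^sub>R (g x - (u x * \<phi> (norm x)) *\<^sub>R x)" for x
    by (cases "x = 0") (simp_all add: k_def algebra_simps)
  have sq: "(norm (k x))\<^sup>2 * (norm x powr (2 * s - 2 * b) * exp (- (2 * l / \<beta>) * norm x powr \<beta>)) =
     (norm (g x))\<^sup>2 * norm x powr (- 2 * b)
     + (s\<^sup>2 * ((u x)\<^sup>2 * norm x powr (- 2 * b - 2))
        - 2 * s * l * ((u x)\<^sup>2 * norm x powr (- (a + b + 1)))
        + l\<^sup>2 * ((u x)\<^sup>2 * norm x powr (- 2 * a)))
     - (2 * s * (u x * (g x \<bullet> x) * norm x powr (- 2 * b - 2))
        - 2 * l * (u x * (g x \<bullet> x) * norm x powr (- (a + b + 1))))" for x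
  proof (cases "x = 0")
    case True
    then show ?thesis using annular_C1_zero[OF u] annular_C1_zero[OF k] by simp
  next
    case False
    define r where "r = norm x"
    have r: "r > 0" using False by (simp add: r_def)
    have vr: "(v r)\<^sup>2 * (r powr (2 * s - 2 * b) * exp (- (2 * l / \<beta>) * r powr \<beta>)) = r powr (- 2 * b)"
    proof -
      have "(v r)\<^sup>2 = r powr (- 2 * s) * exp ((2 * l / \<beta>) * r powr \<beta>)"
      proof -
        have "(v r)\<^sup>2 = (r powr (- s) * r powr (- s)) *
            (exp (l / \<beta> * r powr \<beta>) * exp (l / \<beta> * r powr \<beta>))"
          by (simp add: v_def power2_eq_square)
        then show ?thesis
          by (simp only: powr_add[symmetric] exp_add[symmetric]) simp
      qed
      then have "(v r)\<^sup>2 * (r powr (2 * s - 2 * b) * exp (- (2 * l / \<beta>) * r powr \<beta>)) =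
        (r powr (- 2 * s) * r powr (2 * s - 2 * b)) * (exp ((2 * l / \<beta>) * r powr \<beta>) * exp (- (2 * l / \<beta>) * r powr \<beta>))"
        by simp
      also have "\<dots> = r powr (- 2 * b)"
        by (simp flip: powr_add exp_add)
      finally show ?thesis .
    qed
    have n: "(norm (g x - (u x * \<phi> r) *\<^sub>R x))\<^sup>2 =
        (norm (g x))\<^sup>2 - 2 * (u x * \<phi> r) * (g x \<bullet> x) + (u x)\<^sup>2 * ((\<phi> r)\<^sup>2 * r\<^sup>2)"
      unfolding r_def power2_norm_eq_inner
      by (simp add: inner_diff_left inner_diff_right inner_commute algebra_simps power2_eq_square)
    have p1: "\<phi> r * r powr (- 2 * b) = s * r powr (- 2 * b - 2) - l * r powr (- (a + b + 1))"
    proof -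
      have "- 2 * b - 2 = - 2 + - 2 * b" "- (a + b + 1) = \<beta> - 2 + - 2 * b"
        by (simp_all add: \<beta>_def)
      then have "r powr (- 2 * b - 2) = r powr (- 2) * r powr (- 2 * b)"
           "r powr (- (a + b + 1)) = r powr (\<beta> - 2) * r powr (- 2 * b)"
        by (simp_all only: powr_add)
      then show ?thesis by (simp add: \<phi>_def algebra_simps)
    qed
    have p2: "(\<phi> r)\<^sup>2 * r\<^sup>2 * r powr (- 2 * b) = s\<^sup>2 * r powr (- 2 * b - 2)
        - 2 * s * l * r powr (- (a + b + 1)) + l\<^sup>2 * r powr (- 2 * a)"
    proof -
      have e: "r powr (- 2 * b - 2) = r powr (- 2) * r powr (- 2) * (r powr 2 * r powr (- 2 * b))"
        "r powr (- (a + b + 1)) = r powr (- 2) * r powr (\<beta> - 2) * (r powr 2 * r powr (- 2 * b))"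
        "r powr (- 2 * a) = r powr (\<beta> - 2) * r powr (\<beta> - 2) * (r powr 2 * r powr (- 2 * b))"
      proof -
        have "- 2 * b - 2 = - 2 + - 2 + (2 + - 2 * b)" "- (a + b + 1) = - 2 + (\<beta> - 2) + (2 + - 2 * b)"
          "- 2 * a = (\<beta> - 2) + (\<beta> - 2) + (2 + - 2 * b)"
          by (simp_all add: \<beta>_def)
        then show "r powr (- 2 * b - 2) = r powr (- 2) * r powr (- 2) * (r powr 2 * r powr (- 2 * b))"
          "r powr (- (a + b + 1)) = r powr (- 2) * r powr (\<beta> - 2) * (r powr 2 * r powr (- 2 * b))"
          "r powr (- 2 * a) = r powr (\<beta> - 2) * r powr (\<beta> - 2) * (r powr 2 * r powr (- 2 * b))"
          by (simp_all only: powr_add)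
      qed
      have "r\<^sup>2 = r powr 2" using r by simp
      then show ?thesis unfolding e \<phi>_def by (simp add: power2_eq_square algebra_simps)
    qed
    have "(norm (k x))\<^sup>2 * (r powr (2 * s - 2 * b) * exp (- (2 * l / \<beta>) * r powr \<beta>)) =
      (norm (g x - (u x * \<phi> r) *\<^sub>R x))\<^sup>2 * ((v r)\<^sup>2 * (r powr (2 * s - 2 * b) * exp (- (2 * l / \<beta>) * r powr \<beta>)))"
      unfolding k_eq by (simp add: r_def power_mult_distrib)
    also have "\<dots> = ((norm (g x))\<^sup>2 - 2 * (u x * \<phi> r) * (g x \<bullet> x) + (u x)\<^sup>2 * ((\<phi> r)\<^sup>2 * r\<^sup>2)) * r powr (- 2 * b)"
      unfolding vr n ..
    also have "\<dots> = (norm (g x))\<^sup>2 * r powr (- 2 * b) - 2 * u x * (g x \<bullet> x) * (\<phi> r * r powr (- 2 * b))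
        + (u x)\<^sup>2 * ((\<phi> r)\<^sup>2 * r\<^sup>2 * r powr (- 2 * b))"
      by (simp add: algebra_simps)
    finally show ?thesis unfolding p1 p2 r_def[symmetric]
      by (simp add: algebra_simps)
  qed
  note int = annular_integrable_mult[OF u continuous_on_norm_powr]
  note ibp = radial_integration_by_parts[OF u]
  let ?P = "\<lambda>p. \<integral>x. (u x)\<^sup>2 * norm x powr p \<partial>lborel"
  let ?Q = "\<lambda>p. \<integral>x. u x * (g x \<bullet> x) * norm x powr p \<partial>lborel"
  have "(\<integral>x. (norm (k x))\<^sup>2 * (norm x powr (2 * s - 2 * b) * exp (- (2 * l / \<beta>) * norm x powr \<beta>)) \<partial>lborel) =
    (\<integral>x. (norm (g x))\<^sup>2 * norm x powr (- 2 * b) \<partial>lborel)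
     + (s\<^sup>2 * ?P (- 2 * b - 2) - 2 * s * l * ?P (- (a + b + 1)) + l\<^sup>2 * ?P (- 2 * a))
     - (s * (2 * ?Q (- 2 * b - 2)) - l * (2 * ?Q (- (a + b + 1))))"
    unfolding sq by (simp add: int del: minus_add_distrib)
  also have "\<dots> = (\<integral>x. (norm (g x))\<^sup>2 * norm x powr (- 2 * b) \<partial>lborel)
       + l\<^sup>2 * ?P (- 2 * a)
       - l * (3 * b - a - real DIM('a) + 3) * ?P (- (a + b + 1))"
    unfolding ibp by (simp add: s_def algebra_simps power2_eq_square)
  finally show ?thesis using that[OF k] by simp
qed

section \<open>The Poincare inequality for radial power weights\<close>

text \<open>
  The map \<open>T x = norm x powr (\<kappa> - 1) *\<^sub>R x\<close> turns the weight of \<open>(f x - c)\<^sup>2\<close>, which up to the factor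
  \<open>\<kappa>\<close> is the Jacobian of \<open>T\<close> times \<open>exp (- \<alpha> * (norm (T x))\<^sup>2)\<close>, into a Gaussian weight.
  Pulling \<open>f\<close> back along the inverse of \<open>T\<close> gives a function to which the Gaussian inequality applies. The condition \<open>\<kappa> \<le> 1\<close>
  makes \<open>1 / \<kappa> - 1\<close>, the exponent in the inverse of \<open>T\<close>, nonnegative, so that the Gaussian energy of
  the pulled back function is bounded by the weighted energy of \<open>f\<close>.
\<close>

lemma radial_power_weight_poincare:
  fixes \<kappa> :: real
  assumes \<kappa>: "0 < \<kappa>" "\<kappa> \<le> 1"
  defines "w \<equiv> \<lambda>(p::real) \<alpha> x::'a::euclidean_space. norm x powr p * exp (- \<alpha> * norm x powr (2 * \<kappa>))"
  shows "\<exists>K>0. \<forall>\<alpha>>0. \<forall>f k q. annular_C1 f k \<longrightarrow>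
     (\<forall>c. q \<le> (\<integral>\<^sup>+x. ennreal ((f x - c)\<^sup>2 * w (DIM('a) * (\<kappa> - 1)) \<alpha> x) \<partial>lborel)) \<longrightarrow>
     ennreal \<alpha> * q \<le> ennreal K * (\<integral>\<^sup>+x. ennreal ((norm (k x))\<^sup>2 * w ((real DIM('a) - 2) * (\<kappa> - 1)) \<alpha> x) \<partial>lborel)"
proof -
  let ?N = "real DIM('a)"
  obtain K where K: "K > 0" and poincare: "\<And>\<alpha> (W :: 'a \<Rightarrow> real) g q. \<alpha> > 0 \<Longrightarrow>
     (\<forall>x. GDERIV W x :> g x) \<Longrightarrow> continuous_on UNIV g \<Longrightarrow>
     (\<forall>c. q \<le> (\<integral>\<^sup>+x. ennreal ((W x - c)\<^sup>2 * gauss_weight \<alpha> x) \<partial>lborel)) \<Longrightarrow>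
     ennreal \<alpha> * q \<le> ennreal K * (\<integral>\<^sup>+x. ennreal ((norm (g x))\<^sup>2 * gauss_weight \<alpha> x) \<partial>lborel)"
    using gaussian_poincare[where 'a='a] by blast
  define T where "T x = norm x powr (\<kappa> - 1) *\<^sub>R x" for x :: 'a
  define m where "m = 1 / \<kappa> - 1"
  have m: "m \<ge> 0" using \<kappa> by (simp add: m_def)
  have norm_T: "norm (T x) = norm x powr \<kappa>" for x
    by (cases "x = 0") (simp_all add: T_def powr_diff)
  have T_m: "norm (T x) powr m = norm x powr (1 - \<kappa>)" for x
    using \<kappa> by (simp add: norm_T powr_powr m_def algebra_simps)
  have inv: "norm (T x) powr m *\<^sub>R T x = x" for x
    unfolding T_m by (cases "x = 0") (simp_all add: T_def flip: powr_add)
  have gauss_T: "gauss_weight \<alpha> (T x) = exp (- \<alpha> * norm x powr (2 * \<kappa>))" for \<alpha> x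
    by (simp add: gauss_weight_def norm_T power2_eq_square flip: powr_add)
  have transfer: "(\<integral>\<^sup>+y. ennreal (h y) \<partial>lborel) = ennreal \<kappa> * (\<integral>\<^sup>+x. ennreal (h (T x) * norm x powr (?N * (\<kappa> - 1))) \<partial>lborel)"
    if [measurable]: "h \<in> borel_measurable borel" and "\<And>y. h y \<ge> 0" for h
  proof -
    have [measurable]: "T \<in> borel_measurable borel"
      unfolding T_def by measurable
    have "(\<integral>\<^sup>+y. ennreal (h y) \<partial>lborel) =
      (\<integral>\<^sup>+x. ennreal (h (T x)) * ennreal (\<kappa> * norm x powr (?N * (\<kappa> - 1))) \<partial>lborel)"
      unfolding T_def using \<kappa> by (subst nn_integral_radial_power_map) auto
    also have "\<dots> = (\<integral>\<^sup>+x. ennreal \<kappa> * ennreal (h (T x) * norm x powr (?N * (\<kappa> - 1))) \<partial>lborel)"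
      using \<kappa> that(2) by (simp add: ennreal_mult ac_simps)
    also have "\<dots> = ennreal \<kappa> * (\<integral>\<^sup>+x. ennreal (h (T x) * norm x powr (?N * (\<kappa> - 1))) \<partial>lborel)"
      by (rule nn_integral_cmult) measurable
    finally show ?thesis .
  qed
  show ?thesis
  proof (intro exI[of _ "K / \<kappa>\<^sup>2"] conjI allI impI)
    show "K / \<kappa>\<^sup>2 > 0" using K \<kappa> by simp
    fix \<alpha> :: real and f k q
    assume \<alpha>: "\<alpha> > 0" and f: "annular_C1 f k"
      and q: "\<forall>c. q \<le> (\<integral>\<^sup>+x. ennreal ((f x - c)\<^sup>2 * w (?N * (\<kappa> - 1)) \<alpha> x) \<partial>lborel)"
    obtain g where g: "annular_C1 (\<lambda>y. f (norm y powr m *\<^sub>R y)) g"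
      and g_le: "\<And>y. norm (g y) \<le> (1 + m) * norm y powr m * norm (k (norm y powr m *\<^sub>R y))"
      using annular_C1_pull_back_power[OF f m] by blast
    note [measurable] = annular_C1_measurable[OF f] annular_C1_measurable[OF g]
    let ?W = "\<lambda>y. f (norm y powr m *\<^sub>R y)"
    let ?E = "\<integral>\<^sup>+x. ennreal ((norm (k x))\<^sup>2 * w ((?N - 2) * (\<kappa> - 1)) \<alpha> x) \<partial>lborel"
    have "ennreal \<kappa> * q \<le> (\<integral>\<^sup>+y. ennreal ((?W y - c)\<^sup>2 * gauss_weight \<alpha> y) \<partial>lborel)" for c
    proof -
      have "(\<integral>\<^sup>+y. ennreal ((?W y - c)\<^sup>2 * gauss_weight \<alpha> y) \<partial>lborel) =
        ennreal \<kappa> * (\<integral>\<^sup>+x. ennreal ((f x - c)\<^sup>2 * w (?N * (\<kappa> - 1)) \<alpha> x) \<partial>lborel)"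
        by (subst transfer) (simp_all add: less_imp_le gauss_weight_pos inv gauss_T w_def ac_simps)
      then show ?thesis using q by (simp add: mult_left_mono)
    qed
    then have "ennreal \<alpha> * (ennreal \<kappa> * q) \<le> ennreal K * (\<integral>\<^sup>+y. ennreal ((norm (g y))\<^sup>2 * gauss_weight \<alpha> y) \<partial>lborel)"
      using g by (intro poincare[OF \<alpha>, of ?W]) (auto simp: annular_C1_def)
    also have "(\<integral>\<^sup>+y. ennreal ((norm (g y))\<^sup>2 * gauss_weight \<alpha> y) \<partial>lborel) =
       ennreal \<kappa> * (\<integral>\<^sup>+x. ennreal ((norm (g (T x)))\<^sup>2 * gauss_weight \<alpha> (T x) * norm x powr (?N * (\<kappa> - 1))) \<partial>lborel)"
      by (rule transfer) (simp_all add: less_imp_le gauss_weight_pos)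
    also have "(\<integral>\<^sup>+x. ennreal ((norm (g (T x)))\<^sup>2 * gauss_weight \<alpha> (T x) * norm x powr (?N * (\<kappa> - 1))) \<partial>lborel) \<le>
       (\<integral>\<^sup>+x. ennreal (1 / \<kappa>\<^sup>2) * ennreal ((norm (k x))\<^sup>2 * w ((?N - 2) * (\<kappa> - 1)) \<alpha> x) \<partial>lborel)"
    proof (intro nn_integral_mono)
      fix x :: 'a
      have "norm (g (T x)) \<le> (1 / \<kappa>) * norm x powr (1 - \<kappa>) * norm (k x)"
        using g_le[of "T x", unfolded inv, unfolded T_m] by (simp add: m_def)
      then have "(norm (g (T x)))\<^sup>2 \<le> ((1 / \<kappa>) * norm x powr (1 - \<kappa>) * norm (k x))\<^sup>2"
        by (intro power_mono) auto
      then have "(norm (g (T x)))\<^sup>2 * (gauss_weight \<alpha> (T x) * norm x powr (?N * (\<kappa> - 1))) \<le>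
         ((1 / \<kappa>) * norm x powr (1 - \<kappa>) * norm (k x))\<^sup>2 * (gauss_weight \<alpha> (T x) * norm x powr (?N * (\<kappa> - 1)))"
        by (intro mult_right_mono) (simp_all add: less_imp_le gauss_weight_pos)
      also have "\<dots> = (1 / \<kappa>\<^sup>2) * ((norm (k x))\<^sup>2 * (exp (- \<alpha> * norm x powr (2 * \<kappa>)) *
           ((norm x powr (1 - \<kappa>))\<^sup>2 * norm x powr (?N * (\<kappa> - 1)))))"
        by (simp add: gauss_T power_mult_distrib power_divide)
      also have "(norm x powr (1 - \<kappa>))\<^sup>2 * norm x powr (?N * (\<kappa> - 1)) = norm x powr ((?N - 2) * (\<kappa> - 1))"
        unfolding power2_eq_square powr_add[symmetric] by (rule arg_cong[where f="\<lambda>p. norm x powr p"]) (simp add: algebra_simps)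
      finally have "(norm (g (T x)))\<^sup>2 * gauss_weight \<alpha> (T x) * norm x powr (?N * (\<kappa> - 1)) \<le>
          (1 / \<kappa>\<^sup>2) * ((norm (k x))\<^sup>2 * w ((?N - 2) * (\<kappa> - 1)) \<alpha> x)"
        by (simp add: w_def ac_simps)
      then show "ennreal ((norm (g (T x)))\<^sup>2 * gauss_weight \<alpha> (T x) * norm x powr (?N * (\<kappa> - 1))) \<le>
          ennreal (1 / \<kappa>\<^sup>2) * ennreal ((norm (k x))\<^sup>2 * w ((?N - 2) * (\<kappa> - 1)) \<alpha> x)"
        by (subst ennreal_mult[symmetric]) (auto intro: ennreal_leI simp: w_def)
    qed
    also have "\<dots> = ennreal (1 / \<kappa>\<^sup>2) * ?E"
      by (rule nn_integral_cmult) (simp add: w_def)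
    finally have "ennreal \<alpha> * (ennreal \<kappa> * q) \<le> ennreal K * (ennreal \<kappa> * (ennreal (1 / \<kappa>\<^sup>2) * ?E))"
      by (simp add: mult_left_mono)
    moreover have "ennreal (K / \<kappa>\<^sup>2) = ennreal K * ennreal (1 / \<kappa>\<^sup>2)"
      using K by (subst ennreal_mult[symmetric]) simp_all
    ultimately have "ennreal \<kappa> * (ennreal \<alpha> * q) \<le> ennreal \<kappa> * (ennreal (K / \<kappa>\<^sup>2) * ?E)"
      by (simp only: ac_simps)
    then show "ennreal \<alpha> * q \<le> ennreal (K / \<kappa>\<^sup>2) * ?E"
      using \<kappa> by (simp add: ennreal_mult_le_mult_iff)
  qed
qed

section \<open>Stability of the inequality\<close>

text \<open>
  For \<open>X > 0\<close> and \<open>B > 0\<close> the choice \<open>l = X / B\<close> is the minimiser of the quadratic polynomial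
  \<open>A - 2 * l * X + l\<^sup>2 * B\<close>. Testing all \<open>l > 0\<close> also covers the degenerate cases \<open>A = 0\<close>
  and \<open>B = 0\<close>.
\<close>

lemma geometric_mean_ge:
  fixes A B X :: real
  assumes A: "A \<ge> 0" and B: "B \<ge> 0" and le: "\<And>l. l > 0 \<Longrightarrow> 2 * l * X \<le> A + l\<^sup>2 * B"
  shows "X \<le> sqrt A * sqrt B"
proof (cases "X > 0")
  case False
  have "0 \<le> sqrt A * sqrt B" using A B by simp
  then show ?thesis using False by linarith
next
  case True
  have "B \<noteq> 0"
  proof
    assume "B = 0"
    then have "2 * (A + 1) \<le> A"
      using le[of "(A + 1) / X"] True A by simp
    then show False using A by simp
  qed
  then have B: "B > 0" using B by simp
  have "X\<^sup>2 \<le> A * B"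
    using le[of "X / B"] True B by (simp add: field_simps power2_eq_square)
  then show ?thesis
    by (metis real_le_rsqrt real_sqrt_mult)
qed

theorem theorem1p8:
  fixes a b :: real and N :: nat
  assumes "N = CARD('n::finite)"
    and "N \<ge> 1"
    and "(real N - 2) / 2 < b"
    and "b \<le> real N - 2"
    and "real N * (b - a + 3) = 2 * (3 * b - a + 3)"
  shows "\<exists>C>0. \<forall>u \<in> test_functions (UNIV - {0 :: real ^ 'n}).
    sqrt (LINT x|lborel. (norm (gradient u x))\<^sup>2 / norm x powr (2 * b))
      * sqrt (LINT x|lborel. \<bar>u x\<bar>\<^sup>2 / norm x powr (2 * a))
      - (3 * b - a - real N + 3) / 2 * (LINT x|lborel. \<bar>u x\<bar>\<^sup>2 / norm x powr (a + b + 1))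
    \<ge> C * (INF (c, l) \<in> (UNIV :: real set) \<times> {0 :: real<..}.
        LINT x|lborel.
          \<bar>u x - c * norm x powr (2 * b + 2 - real N)
              * exp (- (l / (b + 1 - a)) * norm x powr (b + 1 - a))\<bar>\<^sup>2
          / norm x powr (a + b + 1))"
proof -
  define s where "s = 2 * b + 2 - real N"
  define \<beta> where "\<beta> = b + 1 - a"
  \<comment> \<open>The assumptions on \<open>b\<close> force \<open>N > 2\<close>, and then say precisely that \<open>0 < \<kappa> \<le> 1\<close>.\<close>
  define \<kappa> where "\<kappa> = s / (real N - 2)"
  have N2: "real N - 2 > 0" and s: "s > 0"
    using assms(3,4) by (auto simp: s_def)
  have \<kappa>: "0 < \<kappa>" "\<kappa> \<le> 1"
    using N2 s assms(4) by (auto simp: \<kappa>_def s_def)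
  have \<kappa>N: "\<kappa> * (real N - 2) = s" using N2 by (simp add: \<kappa>_def)
  have \<beta>\<kappa>: "\<beta> = 2 * \<kappa>"
  proof -
    \<comment> \<open>The balance between \<open>a\<close>, \<open>b\<close> and \<open>N\<close> is what makes the transported weight an exact Gaussian.\<close>
    have "\<beta> * (real N - 2) = 2 * \<kappa> * (real N - 2)"
      using assms(5) \<kappa>N unfolding \<beta>_def s_def by algebra
    then show ?thesis using N2 by simp
  qed
  have \<beta>: "\<beta> > 0" using \<kappa> \<beta>\<kappa> by simp
  have DIM: "real DIM(real ^ 'n) = real N" using assms(1) by simp
  \<comment> \<open>The weights obtained from completing the square are those of the Poincare inequality.\<close>
  have p0: "real N * (\<kappa> - 1) = 2 * s - (a + b + 1)"
    using \<kappa>N \<beta>\<kappa> unfolding \<beta>_def s_def by (simp add: algebra_simps)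
  have p1: "(real N - 2) * (\<kappa> - 1) = 2 * s - 2 * b"
    using \<kappa>N unfolding s_def by (simp add: algebra_simps)
  define w where "w p \<alpha> x = norm x powr p * exp (- \<alpha> * norm x powr (2 * \<kappa>))" for p \<alpha> and x :: "real ^ 'n"
  obtain K where K: "K > 0" and poincare: "\<And>\<alpha> f k q. \<alpha> > 0 \<Longrightarrow> annular_C1 f k \<Longrightarrow>
     (\<forall>c. q \<le> (\<integral>\<^sup>+x. ennreal ((f x - c)\<^sup>2 * w (2 * s - (a + b + 1)) \<alpha> x) \<partial>lborel)) \<Longrightarrow>
     ennreal \<alpha> * q \<le> ennreal K * (\<integral>\<^sup>+x. ennreal ((norm (k x))\<^sup>2 * w (2 * s - 2 * b) \<alpha> x) \<partial>lborel)"
    using radial_power_weight_poincare[OF \<kappa>, where 'a="real ^ 'n", unfolded DIM p0 p1]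
    unfolding w_def by blast
  define C where "C = 1 / (K * \<beta>)"
  have C: "C > 0" using K \<beta> by (simp add: C_def)
  show ?thesis
  proof (intro exI[of _ C] conjI C ballI)
    fix u assume "u \<in> test_functions (UNIV - {0 :: real ^ 'n})"
    then have u: "annular_C1 u (gradient u)" by (rule test_function_annular_C1)
    note [measurable] = annular_C1_measurable[OF u]
    define F where "F c l x = \<bar>u x - c * norm x powr s * exp (- (l / \<beta>) * norm x powr \<beta>)\<bar>\<^sup>2
          / norm x powr (a + b + 1)" for c l x
    have [measurable]: "F c l \<in> borel_measurable borel" for c l
      unfolding F_def by measurable
    define I where "I = (INF (c, l) \<in> (UNIV :: real set) \<times> {0 :: real<..}. LINT x|lborel. F c l x)"
    define A where "A = (LINT x|lborel. (norm (gradient u x))\<^sup>2 / norm x powr (2 * b))"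
    define B where "B = (LINT x|lborel. \<bar>u x\<bar>\<^sup>2 / norm x powr (2 * a))"
    define D where "D = (LINT x|lborel. \<bar>u x\<bar>\<^sup>2 / norm x powr (a + b + 1))"
    have F_nonneg: "F c l x \<ge> 0" for c l x by (simp add: F_def)
    have LF: "(LINT x|lborel. F c l x) \<ge> 0" for c l
      using F_nonneg by (intro integral_nonneg_AE) auto
    have I_nonneg: "I \<ge> 0"
      unfolding I_def by (rule cINF_greatest) (use LF in \<open>auto intro!: exI[of _ 1]\<close>)
    have I_le: "I \<le> (LINT x|lborel. F c l x)" if "l > 0" for c l
    proof -
      have "I \<le> (\<lambda>(c, l). LINT x|lborel. F c l x) (c, l)"
        unfolding I_def
        by (rule cINF_lower) (use that LF in \<open>auto intro!: bdd_belowI2[of _ 0]\<close>)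
      then show ?thesis by simp
    qed
    have A: "A \<ge> 0" unfolding A_def by (intro integral_nonneg_AE) auto
    have B: "B \<ge> 0" unfolding B_def by (intro integral_nonneg_AE) auto
    define X where "X = C * I + (3 * b - a - real N + 3) / 2 * D"
    have "2 * l * X \<le> A + l\<^sup>2 * B" if l: "l > 0" for l
    proof -
      \<comment> \<open>The factor 2 appears because the extremal function enters squared.\<close>
      define \<alpha> where "\<alpha> = 2 * l / \<beta>"
      have \<alpha>: "\<alpha> > 0" using l \<beta> by (simp add: \<alpha>_def)
      define f where "f x = u x * (norm x powr (- s) * exp (l / \<beta> * norm x powr \<beta>))" for x
      have inv_powr: "y / t powr p = y * t powr (- p)" for y t p :: real
        by (simp add: powr_minus_divide)
      have \<beta>0: "\<beta> \<noteq> 0" using \<beta> by simp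
      obtain k where k: "annular_C1 f k" and k_sq:
        "(\<integral>x. (norm (gradient u x))\<^sup>2 * norm x powr (- 2 * b) \<partial>lborel)
          + l\<^sup>2 * (\<integral>x. (u x)\<^sup>2 * norm x powr (- 2 * a) \<partial>lborel)
          - l * (3 * b - a - real N + 3) * (\<integral>x. (u x)\<^sup>2 * norm x powr (- (a + b + 1)) \<partial>lborel) =
        (\<integral>x. (norm (k x))\<^sup>2 * (norm x powr (2 * s - 2 * b) * exp (- (2 * l / \<beta>) * norm x powr \<beta>)) \<partial>lborel)"
        using complete_square[OF u, where a=a and b=b and l=l, unfolded DIM,
            folded s_def \<beta>_def, folded f_def, OF \<beta>0] by blast
      from k_sq have sq: "A + l\<^sup>2 * B - l * (3 * b - a - real N + 3) * D =
         (\<integral>x. (norm (k x))\<^sup>2 * w (2 * s - 2 * b) \<alpha> x \<partial>lborel)"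
        unfolding A_def B_def D_def w_def \<alpha>_def inv_powr power2_abs mult_minus_left \<beta>\<kappa>[symmetric] .
      have F_eq: "(f x - c)\<^sup>2 * w (2 * s - (a + b + 1)) \<alpha> x = F c l x" for c x
      proof (cases "x = 0")
        case False
        define r where "r = norm x"
        define \<psi> where "\<psi> = r powr s * exp (- (l / \<beta>) * r powr \<beta>)"
        have r: "r > 0" using False by (simp add: r_def)
        have \<psi>: "\<psi> > 0" using r by (simp add: \<psi>_def)
        have f\<psi>: "f x * \<psi> = u x"
        proof -
          have "f x * \<psi> = u x * ((r powr (- s) * r powr s) * (exp (l / \<beta> * r powr \<beta>) * exp (- (l / \<beta>) * r powr \<beta>)))"
            by (simp add: f_def \<psi>_def r_def)
          also have "\<dots> = u x"
            unfolding powr_add[symmetric] exp_add[symmetric] using r by simp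
          finally show ?thesis .
        qed
        have w\<psi>: "w (2 * s - (a + b + 1)) \<alpha> x = \<psi>\<^sup>2 / r powr (a + b + 1)"
        proof -
          have "\<psi>\<^sup>2 = r powr (s + s) * exp (- (l / \<beta>) * r powr \<beta> + - (l / \<beta>) * r powr \<beta>)"
            unfolding powr_add exp_add by (simp add: \<psi>_def power2_eq_square)
          also have "\<dots> = r powr (2 * s) * exp (- \<alpha> * r powr \<beta>)"
            by (simp add: \<alpha>_def)
          finally show ?thesis
            by (simp add: w_def r_def[symmetric] \<beta>\<kappa> powr_diff)
        qed
        have "(f x - c)\<^sup>2 * w (2 * s - (a + b + 1)) \<alpha> x = ((f x - c) * \<psi>)\<^sup>2 / r powr (a + b + 1)"
          unfolding w\<psi> by (simp add: power_mult_distrib)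
        also have "(f x - c) * \<psi> = u x - c * \<psi>"
          by (simp add: left_diff_distrib f\<psi>)
        finally show ?thesis by (simp add: F_def \<psi>_def r_def mult.assoc)
      qed (simp add: F_def w_def)
      have "ennreal I \<le> (\<integral>\<^sup>+x. ennreal ((f x - c)\<^sup>2 * w (2 * s - (a + b + 1)) \<alpha> x) \<partial>lborel)" for c
      proof -
        have "ennreal I \<le> ennreal (LINT x|lborel. F c l x)"
          using I_le[OF l] by (rule ennreal_leI)
        \<comment> \<open>This is an equation even if the integral diverges, when both sides are 0.\<close>
        also have "(LINT x|lborel. F c l x) = enn2real (\<integral>\<^sup>+x. ennreal (F c l x) \<partial>lborel)"
          using F_nonneg by (intro integral_eq_nn_integral) auto
        also have "ennreal \<dots> \<le> (\<integral>\<^sup>+x. ennreal (F c l x) \<partial>lborel)"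
          by (cases "\<integral>\<^sup>+x. ennreal (F c l x) \<partial>lborel") auto
        finally show ?thesis unfolding F_eq .
      qed
      then have "ennreal \<alpha> * ennreal I \<le> ennreal K * (\<integral>\<^sup>+x. ennreal ((norm (k x))\<^sup>2 * w (2 * s - 2 * b) \<alpha> x) \<partial>lborel)"
        by (intro poincare[OF \<alpha> k]) auto
      also have "(\<integral>\<^sup>+x. ennreal ((norm (k x))\<^sup>2 * w (2 * s - 2 * b) \<alpha> x) \<partial>lborel) =
          ennreal (\<integral>x. (norm (k x))\<^sup>2 * w (2 * s - 2 * b) \<alpha> x \<partial>lborel)"
      proof (rule nn_integral_eq_integral)
        show "integrable lborel (\<lambda>x. (norm (k x))\<^sup>2 * w (2 * s - 2 * b) \<alpha> x)"
          unfolding w_def by (intro annular_integrable_mult[OF k] continuous_intros) auto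
      qed (simp add: w_def)
      finally have "ennreal \<alpha> * ennreal I \<le>
          ennreal K * ennreal (\<integral>x. (norm (k x))\<^sup>2 * w (2 * s - 2 * b) \<alpha> x \<partial>lborel)" (is "_ \<le> _ * ennreal ?E") .
      moreover have E: "?E \<ge> 0"
        by (intro integral_nonneg_AE) (simp add: w_def)
      moreover have "ennreal \<alpha> * ennreal I = ennreal (\<alpha> * I)"
        using \<alpha> by (intro ennreal_mult'[symmetric]) simp
      moreover have "ennreal K * ennreal ?E = ennreal (K * ?E)"
        using K by (intro ennreal_mult'[symmetric]) simp
      ultimately have "\<alpha> * I \<le> K * ?E"
        using K by (simp only: ennreal_le_iff mult_nonneg_nonneg less_imp_le)
      then have "\<alpha> * I \<le> K * (A + l\<^sup>2 * B - l * (3 * b - a - real N + 3) * D)"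
        unfolding sq .
      then have "2 * l * (C * I) \<le> A + l\<^sup>2 * B - l * (3 * b - a - real N + 3) * D"
        using K \<beta> by (simp add: \<alpha>_def C_def field_simps)
      moreover have "2 * l * X = 2 * l * (C * I) + l * (3 * b - a - real N + 3) * D"
        by (simp add: X_def field_simps)
      ultimately show ?thesis by linarith
    qed
    from geometric_mean_ge[OF A B this] have "C * I \<le> sqrt A * sqrt B - (3 * b - a - real N + 3) / 2 * D"
      by (simp add: X_def)
    then show "C * (INF (c, l) \<in> (UNIV :: real set) \<times> {0 :: real<..}.
        LINT x|lborel.
          \<bar>u x - c * norm x powr (2 * b + 2 - real N)
              * exp (- (l / (b + 1 - a)) * norm x powr (b + 1 - a))\<bar>\<^sup>2
          / norm x powr (a + b + 1))
      \<le> sqrt (LINT x|lborel. (norm (gradient u x))\<^sup>2 / norm x powr (2 * b))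
      * sqrt (LINT x|lborel. \<bar>u x\<bar>\<^sup>2 / norm x powr (2 * a))
      - (3 * b - a - real N + 3) / 2 * (LINT x|lborel. \<bar>u x\<bar>\<^sup>2 / norm x powr (a + b + 1))"
      unfolding I_def F_def s_def \<beta>_def A_def B_def D_def .
  qed
qed

end
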